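(* Assume $n-1\ge p$ and the setting below. For the general shrinkage estimator $$\hat\Theta_G=X-\Sigma^{1/2}HG(\ell)H^\top\Sigma^{-1/2}(X-\bar X),$$ the statistic $$\hat\Delta_G=\sum_{i=1}^p\ell_i\Big\{g_i^2-2(n-1)\frac{g_i}{\ell_i}-2\sum_{k\ne i}\frac{g_i-g_k}{\ell_i-\ell_k}-4\frac{\partial g_i}{\partial\ell_i}\Big\}$$ (with $g_i=g_i(\ell)$) is an unbiased estimator of $np\{R(\Theta,\hat\Theta_G)-R(\Theta,X)\}$, i.e. $E[\hat\Delta_G]=np\{R(\Theta,\hat\Theta_G)-R(\Theta,X)\}$ for all $\Theta$.
   Context: Let $X=(x_1,\dots,x_n)$ be a random $p\times n$ matrix with independent columns $x_i\sim\mathcal N_p(\theta_i,\Sigma)$, $\Sigma$ known positive definite, $\Theta=(\theta_1,\dots,\theta_n)$ unknown. Loss $L(\Theta,\hat\Theta)=\frac1{np}\mathrm{tr}[(\hat\Theta-\Theta)^\top\Sigma^{-1}(\hat\Theta-\Theta)]$, risk $R(\Theta,\hat\Theta)=E[L(\Theta,\hat\Theta)]$. Let $\bar x=n^{-1}\sum_jx_j$, $\bar X=\bar x\,1_n^\top$. Write the spectral decomposition $\Sigma^{-1/2}(X-\bar X)(X-\bar X)^\top\Sigma^{-1/2}=H\mathcal L H^\top$ with $H$ a $p\times p$ orthogonal matrix and $\mathcal L=\mathrm{diag}(\ell_1,\dots,\ell_p)$, $\ell_1\ge\dots\ge\ell_p$ (a.s. distinct and positive), $\ell=(\ell_1,\dots,\ell_p)^\top$.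 Let $G(\ell)=\mathrm{diag}(g_1(\ell),\dots,g_p(\ell))$ where the $g_i$ are differentiable real functions of $\ell$ such that the expectations involved are finite and Stein's identity applies to the entries of $HG H^\top Y$, where $Y=\Sigma^{-1/2}XO_1$ and $O_1$ is an $n\times(n-1)$ matrix with $O_1^\top O_1=I_{n-1}$, $O_1O_1^\top=I_n-n^{-1}1_n1_n^\top$. *)

theory Defs
  imports "HOL-Analysis.Analysis"
begin

text \<open>Matrices: a p x n matrix is real^'n^'p (row index 'p, column index 'n);
  entry (r,c) of A is A $ r $ c.\<close>

definition sym_pd :: "real^'p^'p \<Rightarrow> bool" where
  "sym_pd S \<longleftrightarrow> transpose S = S \<and> (\<forall>x. x \<noteq> 0 \<longrightarrow> 0 < x \<bullet> (S *v x))"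

definition msqrt :: "real^'p^'p \<Rightarrow> real^'p^'p" where
  "msqrt S = (THE R. sym_pd R \<and> R ** R = S)"

definition diag_mat :: "real^'p \<Rightarrow> real^'p^'p" where
  "diag_mat v = (\<chi> i j. if i = j then v $ i else 0)"

definition spec_pair :: "real^('p::{finite,linorder})^('p::{finite,linorder}) \<Rightarrow> (real^('p::{finite,linorder})^('p::{finite,linorder})) \<times> (real^('p::{finite,linorder}))" where
  "spec_pair S = (SOME (H, l). orthogonal_matrix H \<and> S = H ** diag_mat l ** transpose H
       \<and> (\<forall>i j. i \<le> j \<longrightarrow> l $ j \<le> l $ i))"

definition specH :: "real^('p::{finite,linorder})^('p::{finite,linorder}) \<Rightarrow> real^('p::{finite,linorder})^('p::{finite,linorder})" where
  "specH S = fst (spec_pair S)"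

definition specL :: "real^('p::{finite,linorder}) ^('p::{finite,linorder}) \<Rightarrow> real^('p::{finite,linorder})" where
  "specL S = snd (spec_pair S)"

definition Xbar :: "real^'n^'p \<Rightarrow> real^'n^'p" where
  "Xbar X = (\<chi> r c. (\<Sum>j\<in>UNIV. X $ r $ j) / real CARD('n))"

text \<open>Density (w.r.t. Lebesgue measure on p x n matrices) of X with independent
  columns x_i ~ N_p(theta_i, Sigma).\<close>
definition matnormal_density :: "real^'p^'p \<Rightarrow> real^'n^'p \<Rightarrow> real^'n^'p \<Rightarrow> real" where
  "matnormal_density Sig Th X =
     (\<Prod>i\<in>UNIV. exp (- (1/2) * ((column i X - column i Th) \<bullet> (matrix_inv Sig *v (column i X - column i Th))))
                 / sqrt ((2 * pi) ^ CARD('p) * det Sig))"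

definition matnormal :: "real^'p^'p \<Rightarrow> real^'n^'p \<Rightarrow> (real^'n^'p) measure" where
  "matnormal Sig Th = density lborel (\<lambda>X. ennreal (matnormal_density Sig Th X))"

definition loss :: "real^'p^'p \<Rightarrow> real^'n^'p \<Rightarrow> real^'n^'p \<Rightarrow> real" where
  "loss Sig Th T = trace (transpose (T - Th) ** matrix_inv Sig ** (T - Th)) / (real CARD('n) * real CARD('p))"

definition risk :: "real^'p^'p \<Rightarrow> real^'n^'p \<Rightarrow> (real^'n^'p \<Rightarrow> real^'n^'p) \<Rightarrow> real" where
  "risk Sig Th est = integral\<^sup>L (matnormal Sig Th) (\<lambda>X. loss Sig Th (est X))"

definition Smat :: "real^'p^'p \<Rightarrow> real^'n^'p \<Rightarrow> real^'p^'p" where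
  "Smat Sig X = matrix_inv (msqrt Sig) ** (X - Xbar X) ** transpose (X - Xbar X) ** matrix_inv (msqrt Sig)"

definition ThetaG :: "real^('p::{finite,linorder})^('p::{finite,linorder}) \<Rightarrow> (real^('p::{finite,linorder}) \<Rightarrow> real^('p::{finite,linorder})) \<Rightarrow> real^'n^('p::{finite,linorder}) \<Rightarrow> real^'n^('p::{finite,linorder})" where
  "ThetaG Sig g X =
     (let H = specH (Smat Sig X); l = specL (Smat Sig X)
      in X - msqrt Sig ** H ** diag_mat (g l) ** transpose H ** matrix_inv (msqrt Sig) ** (X - Xbar X))"

definition pderiv_g :: "(real^'p \<Rightarrow> real^'p) \<Rightarrow> 'p \<Rightarrow> real^'p \<Rightarrow> real" where
  "pderiv_g g i l = deriv (\<lambda>t. g (l + t *\<^sub>R axis i 1) $ i) 0"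

definition DeltaG :: "real^('p::{finite,linorder})^('p::{finite,linorder}) \<Rightarrow> (real^('p::{finite,linorder}) \<Rightarrow> real^('p::{finite,linorder})) \<Rightarrow> real^'n^('p::{finite,linorder}) \<Rightarrow> real" where
  "DeltaG Sig g X =
     (let l = specL (Smat Sig X)
      in \<Sum>i\<in>UNIV. l $ i * ((g l $ i)\<^sup>2 - 2 * (real CARD('n) - 1) * (g l $ i) / l $ i
            - 2 * (\<Sum>k\<in>UNIV - {i}. (g l $ i - g l $ k) / (l $ i - l $ k))
            - 4 * pderiv_g g i l))"

definition shrinkY :: "(real^('p::{finite,linorder}) \<Rightarrow> real^('p::{finite,linorder})) \<Rightarrow> real^'m^('p::{finite,linorder}) \<Rightarrow> real^'m^('p::{finite,linorder})" where
  "shrinkY g Y = (let H = specH (Y ** transpose Y); l = specL (Y ** transpose Y)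
                  in H ** diag_mat (g l) ** transpose H ** Y)"

definition unit_mat :: "'p \<Rightarrow> 'm \<Rightarrow> real^'m^'p" where
  "unit_mat a b = (\<chi> r c. if r = a \<and> c = b then 1 else 0)"

definition pderiv_entry :: "(real^'m^'p \<Rightarrow> real^'m^'p) \<Rightarrow> 'p \<Rightarrow> 'm \<Rightarrow> real^'m^'p \<Rightarrow> real" where
  "pderiv_entry F a b Y = deriv (\<lambda>t. F (Y + t *\<^sub>R unit_mat a b) $ a $ b) 0"

end

theory Submission
  imports Defs
begin

text \<open>With \<open>Y = \<Sigma>\<^sup>-\<^sup>1\<^sup>/\<^sup>2 X O\<^sub>1\<close> and \<open>M = H G H\<^sup>T\<close>, expanding the loss of the shrinkage estimator gives, for every
  \<open>X\<close>, the loss of \<open>X\<close> minus \<open>2 tr ((Y - E Y)\<^sup>T M Y)\<close> plus \<open>\<Sum>\<^sub>i \<ell>\<^sub>i g\<^sub>i\<^sup>2\<close>. Stein's identity turns the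
  middle term into the divergence of \<open>Y \<mapsto> M Y\<close>. For almost every \<open>X\<close> the spectrum of \<open>Y Y\<^sup>T\<close> is simple
  and positive, because the discriminant times the determinant is a nonzero polynomial in \<open>X\<close>; at such
  points first-order perturbation theory of the eigenvalues and spectral projections yields
  \<open>div (M Y) = \<Sum>\<^sub>i {(n - 1) g\<^sub>i + 2 \<ell>\<^sub>i \<partial>g\<^sub>i/\<partial>\<ell>\<^sub>i + \<ell>\<^sub>i \<Sum>\<^sub>k (g\<^sub>i - g\<^sub>k) / (\<ell>\<^sub>i - \<ell>\<^sub>k)}\<close>.\<close>

section \<open>Spectral decomposition\<close>

text \<open>\<open>spec_pair\<close> is a choice by \<open>SOME\<close>, so nothing is known about
  how \<open>specH\<close> varies with its argument, and no derivative of H is ever taken. What can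
  be differentiated is M: at a simple spectrum it is a combination of spectral projections, whose
  entries are blind to the sign of an eigenvector. Since Stein's identity only involves partial
  derivatives of single entries, one parameter is enough: Y moves along a line Y + t E, and
  everything is evaluated at t = 0 in a frame that diagonalises Y Y^T. The condition n - 1 \<ge> p
  enters through one witness: p orthogonal rows of different lengths fit into n - 1 columns, so the
  exceptional polynomial does not vanish identically. Only the own partial derivatives of the g_i
  survive in the divergence, because the columns of H are orthonormal and the rows of H^T Y
  orthogonal; the coefficients 2 (n - 1), 2 and 4 of the estimator are twice those of the
  divergence.\<close>

lemma symmetric_dot_comm:
  fixes S :: "real^'n^'n"
  assumes "transpose S = S"
  shows "x \<bullet> (S *v y) = (S *v x) \<bullet> y"
  by (metis assms dot_lmul_matrix vector_transpose_matrix)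

text \<open>The maximum \<open>c\<close> of the Rayleigh quotient over the unit sphere of
  \<open>V\<close> is attained by compactness, and a maximiser is an eigenvector: the form
  \<open>c * (y \<bullet> y) - y \<bullet> (S *v y)\<close> is nonnegative on \<open>V\<close> and
  zero at \<open>x\<close>, so its first variation along the residual \<open>w\<close>, which is
  twice the squared norm of \<open>w\<close>, must vanish.\<close>

lemma symmetric_eigenvector_on_subspace:
  fixes S :: "real^'n^'n"
  assumes sym: "transpose S = S" and V: "subspace V"
    and inv: "\<And>v. v \<in> V \<Longrightarrow> S *v v \<in> V" and ne: "V \<noteq> {0}"
  obtains x c where "x \<in> V" "norm x = 1" "S *v x = c *\<^sub>R x"
proof -
  define K where "K = V \<inter> sphere 0 1"
  obtain v where v: "v \<in> V" "v \<noteq> 0" using ne V subspace_0 by blast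
  have "(1 / norm v) *\<^sub>R v \<in> K" using v V by (auto simp: K_def subspace_scale)
  then have Kne: "K \<noteq> {}" by blast
  have Kc: "compact K" unfolding K_def by (simp add: V closed_subspace closed_Int_compact)
  have cont: "continuous_on K (\<lambda>x. x \<bullet> (S *v x))"
    by (intro continuous_intros linear_continuous_on linear_conv_bounded_linear[THEN iffD1]) simp
  obtain x where x: "x \<in> K" and xmax: "\<And>y. y \<in> K \<Longrightarrow> y \<bullet> (S *v y) \<le> x \<bullet> (S *v x)"
    using continuous_attains_sup[OF Kc Kne cont] by blast
  define c where "c = x \<bullet> (S *v x)"
  have xV: "x \<in> V" and x1: "norm x = 1" using x by (auto simp: K_def)
  have q: "0 \<le> c * (y \<bullet> y) - y \<bullet> (S *v y)" if "y \<in> V" for y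
  proof (cases "y = 0")
    case False
    have "(1 / norm y) *\<^sub>R y \<in> K" using that False V by (auto simp: K_def subspace_scale)
    from xmax[OF this] have "(1 / norm y)^2 * (y \<bullet> (S *v y)) \<le> c"
      by (simp add: c_def matrix_vector_mult_scaleR power2_eq_square)
    then have "(norm y)^2 * ((1 / norm y)^2 * (y \<bullet> (S *v y))) \<le> (norm y)^2 * c"
      by (rule mult_left_mono) simp
    then show ?thesis using False by (simp add: power2_norm_eq_inner[symmetric] field_simps power_divide)
  qed simp
  define w where "w = c *\<^sub>R x - S *v x"
  have wV: "w \<in> V" unfolding w_def by (intro subspace_diff subspace_scale V xV inv)
  define Q where "Q = c * (w \<bullet> w) - w \<bullet> (S *v w)"
  have ww: "w \<bullet> w = c * (x \<bullet> w) - w \<bullet> (S *v x)"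
    unfolding w_def by (simp add: inner_diff_left inner_diff_right inner_commute algebra_simps)
  have ineq: "0 \<le> 2 * t * (w \<bullet> w) + t^2 * Q" for t :: real
  proof -
    have "x + t *\<^sub>R w \<in> V" by (intro subspace_add subspace_scale V xV wV)
    from q[OF this]
    have "0 \<le> c * ((x + t *\<^sub>R w) \<bullet> (x + t *\<^sub>R w)) - (x + t *\<^sub>R w) \<bullet> (S *v (x + t *\<^sub>R w))" .
    also have "\<dots> = (c * (x \<bullet> x) - x \<bullet> (S *v x)) + 2 * t * (c * (x \<bullet> w) - w \<bullet> (S *v x)) + t^2 * Q"
      using symmetric_dot_comm[OF sym, of x w] unfolding Q_def
      by (simp add: matrix_vector_right_distrib matrix_vector_mult_scaleR inner_add_left inner_add_right
          inner_commute algebra_simps power2_eq_square)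
    also note ww[symmetric]
    also have "c * (x \<bullet> x) - x \<bullet> (S *v x) = 0"
      using x1 by (simp add: c_def norm_eq_1)
    finally show ?thesis by simp
  qed
  have "w \<bullet> w = 0"
  proof (rule ccontr)
    assume "w \<bullet> w \<noteq> 0"
    then have pos: "w \<bullet> w > 0" by (simp add: inner_gt_zero_iff)
    \<comment> \<open>Negative, and so small that \<open>t * Q\<close> cannot fall below
      \<open>- (w \<bullet> w)\<close>; the linear term then decides the sign.\<close>
    define t where "t = - (w \<bullet> w) / (\<bar>Q\<bar> + 1)"
    have tneg: "t < 0" using pos by (simp add: t_def divide_neg_pos)
    have "- (t * Q) \<le> w \<bullet> w"
    proof -
      have "- (t * Q) \<le> \<bar>t\<bar> * \<bar>Q\<bar>" by (metis abs_ge_minus_self abs_mult)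
      also have "\<dots> \<le> \<bar>t\<bar> * (\<bar>Q\<bar> + 1)" by (simp add: mult_left_mono)
      also have "\<dots> = w \<bullet> w" using pos by (simp add: t_def abs_divide)
      finally show ?thesis .
    qed
    then have "0 < 2 * (w \<bullet> w) + t * Q" using pos by linarith
    then have "t * (2 * (w \<bullet> w) + t * Q) < 0" using tneg by (simp add: mult_neg_pos)
    then show False using ineq[of t] by (simp add: power2_eq_square algebra_simps)
  qed
  then have "S *v x = c *\<^sub>R x" by (simp add: w_def)
  with xV x1 that show thesis by blast
qed

text \<open>Induction on the dimension: by symmetry of \<open>S\<close> the part of \<open>V\<close>
  orthogonal to an eigenvector is again invariant, and its dimension is smaller.\<close>

lemma symmetric_eigenbasis_on_subspace:
  fixes S :: "real^'n^'n"
  assumes sym: "transpose S = S" and "subspace V" and "\<And>v. v \<in> V \<Longrightarrow> S *v v \<in> V"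
  shows "\<exists>B. B \<subseteq> V \<and> pairwise orthogonal B \<and> (\<forall>b\<in>B. norm b = 1) \<and> span B = V
             \<and> (\<forall>b\<in>B. \<exists>c. S *v b = c *\<^sub>R b)"
  using assms(2,3)
proof (induction "dim V" arbitrary: V rule: less_induct)
  case less
  show ?case
  proof (cases "V = {0}")
    case True
    then show ?thesis by (intro exI[of _ "{}"]) auto
  next
    case False
    obtain x c where x: "x \<in> V" "norm x = 1" "S *v x = c *\<^sub>R x"
      using symmetric_eigenvector_on_subspace[OF sym less.prems False] by metis
    define W where "W = V \<inter> {y. orthogonal x y}"
    have W: "subspace W" unfolding W_def
      by (rule subspace_inter[OF less.prems(1) subspace_orthogonal_to_vector])
    have Winv: "S *v v \<in> W" if "v \<in> W" for v
      using that less.prems(2)[of v] x(3) symmetric_dot_comm[OF sym, of x v]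
      by (simp add: W_def orthogonal_def)
    have "x \<notin> W" using x(2) by (auto simp: W_def orthogonal_def)
    then have "W \<subset> V" using x(1) by (auto simp: W_def)
    then have "dim W < dim V" using less.prems(1) W by (metis dim_psubset span_eq_iff)
    from less.hyps[OF this W Winv] obtain B where B: "B \<subseteq> W" "pairwise orthogonal B"
      "\<forall>b\<in>B. norm b = 1" "span B = W" "\<forall>b\<in>B. \<exists>c. S *v b = c *\<^sub>R b" by blast
    have "span (insert x B) = V"
    proof
      show "span (insert x B) \<subseteq> V"
        using B(1) x(1) less.prems(1) by (intro span_minimal) (auto simp: W_def)
      show "V \<subseteq> span (insert x B)"
      proof
        fix y assume y: "y \<in> V"
        have "y - (x \<bullet> y) *\<^sub>R x \<in> W"
          using y x less.prems(1)
          by (auto simp: W_def orthogonal_def inner_diff_right norm_eq_1 intro!: subspace_diff subspace_scale)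
        then show "y \<in> span (insert x B)" using B(4) span_breakdown_eq by blast
      qed
    qed
    moreover have "pairwise orthogonal (insert x B)"
      using B(1,2) by (auto simp: pairwise_insert W_def orthogonal_commute)
    ultimately show ?thesis using B x by (intro exI[of _ "insert x B"]) (auto simp: W_def)
  qed
qed

lemma matrix_mult_entry: "(A ** B) $ i $ j = (\<Sum>k\<in>UNIV. A $ i $ k * B $ k $ j)"
  by (simp add: matrix_matrix_mult_def)

lemma diag_conj_entry:
  fixes H :: "real^'p^'q" and H' :: "real^'r^'p"
  shows "(H ** diag_mat l ** H') $ i $ j = (\<Sum>k\<in>UNIV. H $ i $ k * l $ k * H' $ k $ j)"
proof -
  have "(\<Sum>k\<in>UNIV. H $ i $ k * (if k = m then l $ k else 0)) = H $ i $ m * l $ m" for m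
    by (simp add: if_distrib[of "\<lambda>x. _ * x"] cong: if_cong)
  then show ?thesis by (simp add: matrix_mult_entry diag_mat_def)
qed

lemma matrix_mult_diag_entry:
  fixes H :: "real^'p^'q"
  shows "(H ** diag_mat l) $ i $ m = H $ i $ m * l $ m"
  by (simp add: matrix_mult_entry diag_mat_def if_distrib[of "\<lambda>x. _ * x"] cong: if_cong)

lemma orthogonal_matrix_mult_transpose:
  fixes H :: "real^'n^'n"
  assumes "orthogonal_matrix H"
  shows "H ** transpose H = mat 1" "transpose H ** H = mat 1"
  using assms by (auto simp: orthogonal_matrix_def)

lemma symmetric_diagonalizable:
  fixes S :: "real^'n^'n"
  assumes sym: "transpose S = S"
  obtains H l where "orthogonal_matrix H" "S = H ** diag_mat l ** transpose H"
proof -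
  obtain B where B: "pairwise orthogonal B" "\<forall>b\<in>B. norm b = 1" "span B = UNIV"
    "\<forall>b\<in>B. \<exists>c. S *v b = c *\<^sub>R b"
    using symmetric_eigenbasis_on_subspace[OF sym subspace_UNIV] by auto
  have "0 \<notin> B" using B(2) by auto
  then have indep: "independent B" using B(1) pairwise_orthogonal_independent by blast
  then have "card B = CARD('n)"
    using B(3) by (metis dim_UNIV dim_span_eq_card_independent DIM_cart DIM_real mult.right_neutral)
  moreover have "finite B" using indep by (rule independent_imp_finite)
  ultimately obtain f where f: "bij_betw f (UNIV::'n set) B"
    using finite_same_card_bij[of "UNIV::'n set" B] by auto
  have fB: "f i \<in> B" for i using f by (auto simp: bij_betw_def)
  have finj: "f i = f j \<longleftrightarrow> i = j" for i j using f by (auto simp: bij_betw_def inj_def)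
  have "\<forall>i. \<exists>c. S *v f i = c *\<^sub>R f i" using B(4) fB by blast
  then obtain l where l: "\<And>i. S *v f i = l i *\<^sub>R f i" unfolding choice_iff by blast
  define H :: "real^'n^'n" where "H = (\<chi> r c. f c $ r)"
  have col: "column c H = f c" for c by (simp add: H_def column_def vec_eq_iff)
  have "norm (f i) = 1" for i using B(2) fB by blast
  moreover have "orthogonal (f i) (f j)" if "i \<noteq> j" for i j
    using B(1) fB that finj by (auto simp: pairwise_def)
  ultimately have H: "orthogonal_matrix H"
    unfolding orthogonal_matrix_orthonormal_columns col by auto
  have "S ** H = H ** diag_mat (\<chi> i. l i)"
  proof -
    have "(S ** H) $ i $ j = (S *v f j) $ i" for i j
      by (simp add: matrix_mult_entry matrix_vector_mult_def H_def)
    then show ?thesis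
      by (simp add: vec_eq_iff l matrix_mult_diag_entry H_def mult.commute)
  qed
  then have "S ** H ** transpose H = H ** diag_mat (\<chi> i. l i) ** transpose H" by simp
  then have "S = H ** diag_mat (\<chi> i. l i) ** transpose H"
    by (metis H matrix_mul_assoc matrix_mul_rid orthogonal_matrix_mult_transpose(1))
  with H that show thesis by blast
qed

text \<open>The position of an index, counted from 0. It addresses list positions when eigenvalues
  are sorted, and later supplies the exponents 0, ..., p - 1 of a Vandermonde matrix.\<close>

definition rank_of :: "'p::{finite,linorder} \<Rightarrow> nat" where
  "rank_of i = card {j. j < i}"

lemma rank_of_less_iff: "rank_of i < rank_of j \<longleftrightarrow> i < j"
proof -
  have *: "rank_of i < rank_of j" if "i < j" for i j :: 'a
    unfolding rank_of_def using that by (intro psubset_card_mono) auto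
  show ?thesis using *[of i j] *[of j i] by (metis less_asym' linorder_neqE order_less_irrefl)
qed

lemma rank_of_less: "rank_of (i :: 'p::{finite,linorder}) < CARD('p)"
  unfolding rank_of_def by (intro psubset_card_mono) auto

lemma inj_rank_of: "inj rank_of"
  by (rule linorder_injI) (metis rank_of_less_iff order_less_irrefl)

lemma rank_of_le_iff: "rank_of i \<le> rank_of j \<longleftrightarrow> i \<le> j"
  using rank_of_less_iff[of j i] by (simp add: not_less[symmetric])

lemma sorting_permutation:
  fixes v :: "'p::{finite,linorder} \<Rightarrow> real"
  shows "\<exists>s :: 'p \<Rightarrow> 'p. bij s \<and> (\<forall>i j. i \<le> j \<longrightarrow> v (s j) \<le> v (s i))"
proof -
  define xs where "xs = sort_key (\<lambda>i. - v i) (sorted_list_of_set UNIV)"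
  have len: "length xs = CARD('p)" and dist: "distinct xs"
    by (simp_all add: xs_def)
  have srt: "sorted (map (\<lambda>i. - v i) xs)" by (simp add: xs_def)
  define s :: "'p \<Rightarrow> 'p" where "s = (\<lambda>i. xs ! rank_of i)"
  have "inj s"
    by (rule injI) (simp add: s_def nth_eq_iff_index_eq[OF dist] rank_of_less len inj_eq[OF inj_rank_of])
  then have "bij s" by (simp add: bij_def finite_UNIV_inj_surj)
  moreover have "v (s j) \<le> v (s i)" if "i \<le> j" for i j
    using sorted_nth_mono[OF srt, of "rank_of i" "rank_of j"] rank_of_less[of i] rank_of_less[of j] that
    by (simp add: s_def len rank_of_le_iff)
  ultimately show ?thesis by blast
qed

text \<open>Permuting the columns of H along with the eigenvalues keeps the factorisation, so any
  diagonalisation can be sorted; hence the choice in \<open>spec_pair\<close> is not void.\<close>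

lemma spec_pair_exists:
  fixes S :: "real^('p::{finite,linorder})^('p::{finite,linorder})"
  assumes sym: "transpose S = S"
  shows "\<exists>H l. orthogonal_matrix H \<and> S = H ** diag_mat l ** transpose H \<and> (\<forall>i j. i \<le> j \<longrightarrow> l $ j \<le> l $ i)"
proof -
  obtain H l where H: "orthogonal_matrix H" "S = H ** diag_mat l ** transpose H"
    using symmetric_diagonalizable[OF sym] .
  obtain s :: "'p \<Rightarrow> 'p" where s: "bij s" "\<And>i j. i \<le> j \<Longrightarrow> l $ s j \<le> l $ s i"
    using sorting_permutation[of "\<lambda>i. l $ i"] by blast
  define K where "K = (\<chi> r c. H $ r $ s c)"
  have reind: "(\<Sum>k\<in>UNIV. h (s k)) = (\<Sum>k\<in>UNIV. h k)" for h :: "'p \<Rightarrow> real"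
    using sum.reindex_bij_betw[OF s(1)] .
  have "K ** transpose K = mat 1"
    using orthogonal_matrix_mult_transpose(1)[OF H(1)]
    by (simp add: vec_eq_iff matrix_mult_entry K_def transpose_def reind[of "\<lambda>k. H $ _ $ k * H $ _ $ k"])
  then have "orthogonal_matrix K"
    using matrix_left_right_inverse orthogonal_matrix_def by blast
  moreover have "S = K ** diag_mat (\<chi> i. l $ s i) ** transpose K"
    unfolding H(2) by (simp add: vec_eq_iff diag_conj_entry K_def transpose_def
        reind[of "\<lambda>k. H $ _ $ k * l $ k * H $ _ $ k"])
  ultimately show ?thesis using s(2) by (intro exI[of _ K] exI[of _ "\<chi> i. l $ s i"]) simp
qed

text \<open>After this lemma the choice behind \<open>specH\<close> and \<open>specL\<close> is
  never unfolded again; only these three properties are available.\<close>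

lemma spec_decomp:
  fixes S :: "real^('p::{finite,linorder})^('p::{finite,linorder})"
  assumes sym: "transpose S = S"
  shows "orthogonal_matrix (specH S)" "S = specH S ** diag_mat (specL S) ** transpose (specH S)"
    "i \<le> j \<Longrightarrow> specL S $ j \<le> specL S $ i"
proof -
  let ?P = "\<lambda>(H, l). orthogonal_matrix H \<and> S = H ** diag_mat l ** transpose H \<and> (\<forall>i j. i \<le> j \<longrightarrow> l $ j \<le> l $ i)"
  have "?P (spec_pair S)" unfolding spec_pair_def
    by (rule someI_ex) (use spec_pair_exists[OF sym] in auto)
  then show "orthogonal_matrix (specH S)" "S = specH S ** diag_mat (specL S) ** transpose (specH S)"
    "i \<le> j \<Longrightarrow> specL S $ j \<le> specL S $ i"
    by (auto simp: specH_def specL_def split: prod.splits)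
qed

section \<open>Square roots and the expansion of the loss\<close>

lemma transpose_diag_mat [simp]: "transpose (diag_mat l) = diag_mat l"
  by (simp add: vec_eq_iff transpose_def diag_mat_def)

lemma matrix_diff_ldistrib: "A ** (B - C) = A ** B - A ** C" for A :: "real^'n^'m"
  by (simp add: vec_eq_iff matrix_mult_entry right_diff_distrib sum_subtractf)

lemma matrix_diff_rdistrib: "(B - C) ** A = B ** A - C ** A" for A :: "real^'n^'m"
  by (simp add: vec_eq_iff matrix_mult_entry left_diff_distrib sum_subtractf)

lemma matrix_inv_inverse:
  assumes "invertible A"
  shows "A ** matrix_inv A = mat 1" "matrix_inv A ** A = mat 1"
  using someI_ex[OF assms[unfolded invertible_def]] by (simp_all add: matrix_inv_def)

lemma transpose_diag_conj:
  "transpose (H ** diag_mat l ** transpose H) = H ** diag_mat l ** transpose H"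
  for H :: "real^'n^'n"
  by (simp add: matrix_transpose_mul matrix_mul_assoc)

lemma diag_conj_mult:
  fixes H :: "real^'n^'n"
  assumes "orthogonal_matrix H"
  shows "(H ** diag_mat u ** transpose H) ** (H ** diag_mat v ** transpose H)
       = H ** diag_mat (\<chi> i. u $ i * v $ i) ** transpose H"
proof -
  have "(H ** diag_mat u ** transpose H) ** (H ** diag_mat v ** transpose H)
      = H ** (diag_mat u ** (transpose H ** H) ** diag_mat v) ** transpose H"
    by (simp add: matrix_mul_assoc)
  also have "\<dots> = H ** (diag_mat u ** diag_mat v) ** transpose H"
    by (simp add: orthogonal_matrix_mult_transpose[OF assms])
  also have "diag_mat u ** diag_mat v = diag_mat (\<chi> i. u $ i * v $ i)"
    by (simp add: vec_eq_iff matrix_mult_diag_entry) (simp add: diag_mat_def)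
  finally show ?thesis .
qed

lemma diag_conj_mult_vec:
  fixes H :: "real^'n^'n"
  shows "x \<bullet> ((H ** diag_mat l ** transpose H) *v x) = (\<Sum>k\<in>UNIV. l $ k * ((transpose H *v x) $ k)\<^sup>2)"
proof -
  have "x \<bullet> ((H ** diag_mat l ** transpose H) *v x) = (transpose H *v x) \<bullet> (diag_mat l *v (transpose H *v x))"
    by (metis dot_lmul_matrix matrix_vector_mul_assoc vector_transpose_matrix transpose_transpose)
  moreover have "(diag_mat l *v y) $ k = l $ k * y $ k" for y k
    by (simp add: matrix_vector_mult_def diag_mat_def if_distrib[of "\<lambda>x. x * _"] cong: if_cong)
  ultimately show ?thesis by (simp add: inner_vec_def power2_eq_square mult_ac)
qed

lemma orthogonal_conj_cancel:
  fixes H :: "real^'n^'n"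
  assumes "orthogonal_matrix H" "S = H ** D ** transpose H"
  shows "transpose H ** S ** H = D"
proof -
  have "transpose H ** S ** H = (transpose H ** H) ** D ** (transpose H ** H)"
    by (simp add: assms(2) matrix_mul_assoc)
  then show ?thesis by (simp add: orthogonal_matrix_mult_transpose[OF assms(1)])
qed

lemma eigenvalue_eq_quadratic_form:
  fixes H :: "real^'n^'n"
  assumes "orthogonal_matrix H" "S = H ** diag_mat l ** transpose H"
  shows "l $ i = column i H \<bullet> (S *v column i H)" "S *v column i H = l $ i *\<^sub>R column i H"
proof -
  have "S ** H = H ** diag_mat l"
    by (metis assms matrix_mul_assoc matrix_mul_rid orthogonal_matrix_mult_transpose(2))
  moreover have "column i (S ** H) = S *v column i H"
    by (simp add: column_def matrix_mult_entry matrix_vector_mult_def vec_eq_iff)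
  moreover have "column i (H ** diag_mat l) = l $ i *\<^sub>R column i H"
    by (simp add: column_def matrix_mult_diag_entry vec_eq_iff)
  ultimately show 2: "S *v column i H = l $ i *\<^sub>R column i H" by metis
  have "norm (column i H) = 1" using assms(1) orthogonal_matrix_orthonormal_columns by blast
  then show "l $ i = column i H \<bullet> (S *v column i H)" by (simp add: 2 norm_eq_1)
qed

lemma orthogonal_column_nonzero:
  fixes H :: "real^'n^'n"
  assumes "orthogonal_matrix H"
  shows "column i H \<noteq> 0"
  by (metis assms norm_zero orthogonal_matrix_orthonormal_columns zero_neq_one)

section \<open>Positive definite square roots and their inverses\<close>

lemma sym_pd_sqrt_exists:
  fixes S :: "real^'p^'p"
  assumes "sym_pd S"
  shows "\<exists>R. sym_pd R \<and> R ** R = S"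
proof -
  have sym: "transpose S = S" and pos: "\<And>x. x \<noteq> 0 \<Longrightarrow> 0 < x \<bullet> (S *v x)"
    using assms by (auto simp: sym_pd_def)
  obtain H l where H: "orthogonal_matrix H" "S = H ** diag_mat l ** transpose H"
    using symmetric_diagonalizable[OF sym] .
  have lpos: "l $ i > 0" for i
    using pos[OF orthogonal_column_nonzero[OF H(1), of i]] eigenvalue_eq_quadratic_form(1)[OF H] by simp
  define R where "R = H ** diag_mat (\<chi> i. sqrt (l $ i)) ** transpose H"
  have "R ** R = S"
    unfolding R_def diag_conj_mult[OF H(1)]
    using lpos by (simp add: H(2) order_less_imp_le)
  moreover have "0 < x \<bullet> (R *v x)" if "x \<noteq> 0" for x
  proof -
    have "H *v (transpose H *v x) = x"
      by (simp only: matrix_vector_mul_assoc orthogonal_matrix_mult_transpose[OF H(1)] matrix_vector_mul_lid)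
    then have "transpose H *v x \<noteq> 0" using that by (metis matrix_vector_mult_0_right)
    then obtain k where "(transpose H *v x) $ k \<noteq> 0" by (auto simp: vec_eq_iff)
    then show ?thesis unfolding R_def diag_conj_mult_vec
      by (intro sum_pos2[where i=k]) (auto simp: lpos intro!: mult_pos_pos mult_nonneg_nonneg less_imp_le[OF lpos])
  qed
  ultimately show ?thesis
    by (intro exI[of _ R]) (auto simp: sym_pd_def R_def transpose_diag_conj)
qed

text \<open>As \<open>R\<close> and \<open>Q\<close> need not commute, the difference of their
  squares is written as \<open>R ** (R - Q) + (R - Q) ** Q\<close>. On an eigenvector of
  \<open>R - Q\<close> its quadratic form is the eigenvalue times a sum of two positive numbers, so
  every eigenvalue of \<open>R - Q\<close> is zero.\<close>

lemma sym_pd_sqrt_unique: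
  fixes R Q :: "real^'p^'p"
  assumes R: "sym_pd R" and Q: "sym_pd Q" and eq: "R ** R = Q ** Q"
  shows "R = Q"
proof -
  have sym: "transpose (R - Q) = R - Q"
    using R Q by (simp add: sym_pd_def transpose_def vec_eq_iff)
  obtain K d where K: "orthogonal_matrix K" "R - Q = K ** diag_mat d ** transpose K"
    using symmetric_diagonalizable[OF sym] .
  have id: "R ** (R - Q) + (R - Q) ** Q = 0"
    by (simp add: matrix_diff_ldistrib matrix_diff_rdistrib eq)
  have "d $ i = 0" for i
  proof -
    define v where "v = column i K"
    have v: "v \<noteq> 0" and Dv: "(R - Q) *v v = d $ i *\<^sub>R v"
      using orthogonal_column_nonzero[OF K(1)] eigenvalue_eq_quadratic_form(2)[OF K] by (auto simp: v_def)
    have "0 = v \<bullet> ((R ** (R - Q) + (R - Q) ** Q) *v v)" by (simp add: id)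
    also have "\<dots> = v \<bullet> (R *v ((R - Q) *v v)) + v \<bullet> ((R - Q) *v (Q *v v))"
      by (simp add: matrix_vector_mult_add_rdistrib inner_add_right matrix_vector_mul_assoc)
    also have "v \<bullet> ((R - Q) *v (Q *v v)) = ((R - Q) *v v) \<bullet> (Q *v v)"
      by (rule symmetric_dot_comm[OF sym])
    finally have "0 = v \<bullet> (R *v (d $ i *\<^sub>R v)) + (d $ i *\<^sub>R v) \<bullet> (Q *v v)"
      by (simp only: Dv)
    then have "0 = d $ i * (v \<bullet> (R *v v) + v \<bullet> (Q *v v))"
      by (simp add: matrix_vector_mult_scaleR algebra_simps)
    moreover have "v \<bullet> (R *v v) + v \<bullet> (Q *v v) > 0"
      using R Q v by (auto simp: sym_pd_def intro: add_pos_pos)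
    ultimately show ?thesis by simp
  qed
  then have "diag_mat d = 0" by (simp add: diag_mat_def vec_eq_iff)
  then have "R - Q = 0" using K(2) by simp
  then show ?thesis by simp
qed

lemma msqrt:
  assumes "sym_pd S"
  shows "sym_pd (msqrt S)" "msqrt S ** msqrt S = S"
proof -
  have "\<exists>!R. sym_pd R \<and> R ** R = S"
    using sym_pd_sqrt_exists[OF assms] sym_pd_sqrt_unique by metis
  from theI'[OF this] show "sym_pd (msqrt S)" "msqrt S ** msqrt S = S"
    unfolding msqrt_def by auto
qed

lemma sym_pd_invertible:
  assumes "sym_pd S"
  shows "invertible S"
proof -
  have "S *v x = 0 \<Longrightarrow> x = 0" for x
    using assms by (auto simp: sym_pd_def)
  then show ?thesis
    using matrix_left_invertible_ker invertible_left_inverse by metis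
qed

lemma matrix_inv_msqrt:
  fixes S :: "real^'p^'p"
  assumes "sym_pd S"
  defines "Ri \<equiv> matrix_inv (msqrt S)"
  shows "Ri ** msqrt S = mat 1" "transpose Ri = Ri" "matrix_inv S = Ri ** Ri"
proof -
  have inv: "invertible (msqrt S)" using sym_pd_invertible msqrt(1)[OF assms(1)] by blast
  show 1: "Ri ** msqrt S = mat 1" and 2: "transpose Ri = Ri"
  proof -
    show 1: "Ri ** msqrt S = mat 1" by (simp add: Ri_def inv matrix_inv_inverse(2))
    have "transpose (msqrt S) = msqrt S" using msqrt(1)[OF assms(1)] by (simp add: sym_pd_def)
    then have "msqrt S ** transpose Ri = mat 1"
      using 1 by (metis matrix_transpose_mul transpose_mat)
    then have "Ri ** (msqrt S ** transpose Ri) = Ri" by simp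
    then show "transpose Ri = Ri" by (simp add: matrix_mul_assoc 1)
  qed
  have "(Ri ** Ri) ** S = Ri ** (Ri ** msqrt S) ** msqrt S"
    by (subst msqrt(2)[OF assms(1), symmetric]) (simp add: matrix_mul_assoc)
  then have "(Ri ** Ri) ** S = mat 1" by (simp add: 1)
  then have "(Ri ** Ri) ** S ** matrix_inv S = matrix_inv S" by simp
  then show "matrix_inv S = Ri ** Ri"
    by (metis assms(1) matrix_inv_inverse(1) matrix_mul_assoc matrix_mul_rid sym_pd_invertible)
qed

text \<open>The inner product of the matrix type is the Frobenius one, so losses can be expanded as
  squared norms.\<close>

lemma trace_transpose_mult: "trace (transpose A ** B) = A \<bullet> B"
  for A B :: "real^'n^'m"
  by (simp add: trace_def matrix_mult_entry inner_vec_def transpose_def) (rule sum.swap)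

lemma inner_matrix_mult_right:
  fixes A :: "real^'n^'m"
  shows "A \<bullet> (B ** C) = (A ** transpose C) \<bullet> B"
proof -
  have "(\<Sum>j\<in>UNIV. A $ i $ j * (\<Sum>k\<in>UNIV. B $ i $ k * C $ k $ j))
      = (\<Sum>k\<in>UNIV. (\<Sum>j\<in>UNIV. A $ i $ j * C $ k $ j) * B $ i $ k)" for i
    unfolding sum_distrib_left sum_distrib_right by (subst sum.swap) (simp add: mult_ac)
  then show ?thesis by (simp add: inner_vec_def matrix_mult_entry transpose_def)
qed

lemma inner_transpose: "transpose A \<bullet> transpose B = A \<bullet> B"
  for A B :: "real^'n^'m"
  by (simp add: inner_vec_def transpose_def) (rule sum.swap)

lemma centered_eq_proj:
  fixes X :: "real^'n^'p" and O1 :: "real^'m^'n"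
  assumes "O1 ** transpose O1 = mat 1 - (\<chi> i j. 1 / real CARD('n))"
  shows "X - Xbar X = X ** O1 ** transpose O1"
proof -
  have "X ** O1 ** transpose O1 = X ** (O1 ** transpose O1)" by (simp add: matrix_mul_assoc)
  also have "\<dots> = X - X ** (\<chi> i j. 1 / real CARD('n))"
    by (simp add: assms matrix_diff_ldistrib)
  also have "X ** (\<chi> i j. 1 / real CARD('n)) = Xbar X"
    by (simp add: vec_eq_iff matrix_mult_entry Xbar_def sum_divide_distrib)
  finally show ?thesis by simp
qed

text \<open>Centring is right multiplication by \<open>O1 ** transpose O1\<close>, and in the Gram
  matrix the inner factor \<open>transpose O1 ** O1\<close> cancels. Both sides being the same
  matrix, \<open>ThetaG\<close> and \<open>shrinkY\<close> work with the same chosen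
  eigenvectors.\<close>

lemma Smat_eq:
  fixes X :: "real^'n^'p" and O1 :: "real^'m^'n"
  assumes pd: "sym_pd Sig"
    and orth: "transpose O1 ** O1 = mat 1"
    and proj: "O1 ** transpose O1 = mat 1 - (\<chi> i j. 1 / real CARD('n))"
  defines "Y \<equiv> matrix_inv (msqrt Sig) ** X ** O1"
  shows "Smat Sig X = Y ** transpose Y"
proof -
  let ?Ri = "matrix_inv (msqrt Sig)"
  have "Smat Sig X = Y ** (transpose O1 ** O1) ** transpose Y"
    unfolding Smat_def centered_eq_proj[OF proj] Y_def
    by (simp add: matrix_transpose_mul matrix_mul_assoc matrix_inv_msqrt(2)[OF pd])
  then show ?thesis by (simp add: orth)
qed

lemma shrinkY_norm:
  fixes Y :: "real^'m^('p::{finite,linorder})" and g :: "real^('p::{finite,linorder}) \<Rightarrow> real^('p::{finite,linorder})"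
  defines "l \<equiv> specL (Y ** transpose Y)"
  shows "shrinkY g Y \<bullet> shrinkY g Y = (\<Sum>i\<in>UNIV. l $ i * (g l $ i)\<^sup>2)"
proof -
  have sym: "transpose (Y ** transpose Y) = Y ** transpose Y" by (simp add: matrix_transpose_mul)
  define H where "H = specH (Y ** transpose Y)"
  have H: "orthogonal_matrix H" and S: "Y ** transpose Y = H ** diag_mat l ** transpose H"
    using spec_decomp[OF sym] by (simp_all add: H_def l_def)
  define M where "M = H ** diag_mat (g l) ** transpose H"
  have M: "shrinkY g Y = M ** Y" by (simp add: shrinkY_def M_def H_def l_def Let_def)
  \<comment> \<open>The transposes turn the trace of (M Y)^T (M Y) into that of (M Y) (M Y)^T, in
    which Y Y^T appears and is diagonal in the same basis as \<open>M\<close>.\<close>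
  have "(M ** Y) \<bullet> (M ** Y) = trace (transpose (transpose (M ** Y)) ** transpose (M ** Y))"
    by (simp only: trace_transpose_mult inner_transpose)
  also have "transpose (transpose (M ** Y)) ** transpose (M ** Y) = M ** (Y ** transpose Y) ** M"
    by (simp add: matrix_transpose_mul matrix_mul_assoc) (simp add: M_def matrix_transpose_mul matrix_mul_assoc)
  also have "\<dots> = H ** diag_mat (\<chi> i. g l $ i * l $ i * g l $ i) ** transpose H"
    unfolding S M_def diag_conj_mult[OF H] by simp
  also have "trace \<dots> = trace (transpose H ** H ** diag_mat (\<chi> i. g l $ i * l $ i * g l $ i))"
    by (subst trace_mul_sym) (simp only: matrix_mul_assoc)
  also have "\<dots> = (\<Sum>i\<in>UNIV. g l $ i * l $ i * g l $ i)"
    by (simp add: orthogonal_matrix_mult_transpose[OF H]) (simp add: trace_def diag_mat_def)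
  finally show ?thesis by (simp add: M power2_eq_square mult_ac)
qed

lemma loss_eq_norm:
  fixes T :: "real^'n^'p"
  assumes pd: "sym_pd Sig"
  shows "real CARD('n) * real CARD('p) * loss Sig Th T
       = (matrix_inv (msqrt Sig) ** (T - Th)) \<bullet> (matrix_inv (msqrt Sig) ** (T - Th))"
  unfolding trace_transpose_mult[symmetric]
  by (simp add: loss_def matrix_inv_msqrt[OF pd] matrix_transpose_mul matrix_mul_assoc)

text \<open>Whitened by \<open>Ri\<close>, the residual of the estimator is
  \<open>U - W ** transpose O1\<close>, and the claim is the expansion of its squared norm. In the
  cross term \<open>transpose O1\<close> moves over to \<open>U\<close> and leaves \<open>Y\<close>
  minus its mean; in the last term it cancels.\<close>

lemma loss_ThetaG:
  fixes X Th :: "real^'n^('p::{finite,linorder})" and O1 :: "real^'m^'n"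
    and g :: "real^('p::{finite,linorder}) \<Rightarrow> real^('p::{finite,linorder})"
  assumes pd: "sym_pd Sig"
    and orth: "transpose O1 ** O1 = mat 1"
    and proj: "O1 ** transpose O1 = mat 1 - (\<chi> i j. 1 / real CARD('n))"
  defines "Ri \<equiv> matrix_inv (msqrt Sig)" and "l \<equiv> specL (Smat Sig X)"
  shows "real CARD('n) * real CARD('p) * loss Sig Th (ThetaG Sig g X)
    = real CARD('n) * real CARD('p) * loss Sig Th X
      - 2 * (\<Sum>a\<in>UNIV. \<Sum>b\<in>UNIV. ((Ri ** X ** O1) $ a $ b - (Ri ** Th ** O1) $ a $ b) * shrinkY g (Ri ** X ** O1) $ a $ b)
      + (\<Sum>i\<in>UNIV. l $ i * (g l $ i)\<^sup>2)"
proof -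
  define Y where "Y = Ri ** X ** O1"
  define U where "U = Ri ** (X - Th)"
  define W where "W = shrinkY g Y"
  have S: "Smat Sig X = Y ** transpose Y" using Smat_eq[OF pd orth proj] by (simp add: Y_def Ri_def)
  have "Ri ** (ThetaG Sig g X - Th) = U - W ** transpose O1"
  proof -
    define M where "M = specH (Smat Sig X) ** diag_mat (g l) ** transpose (specH (Smat Sig X))"
    have "ThetaG Sig g X - Th = (X - Th) - msqrt Sig ** M ** (Ri ** (X - Xbar X))"
      by (simp add: ThetaG_def Let_def l_def M_def Ri_def matrix_mul_assoc)
    also have "Ri ** (X - Xbar X) = Y ** transpose O1"
      by (simp add: centered_eq_proj[OF proj] Y_def matrix_mul_assoc)
    finally have "Ri ** (ThetaG Sig g X - Th) = U - (Ri ** msqrt Sig) ** M ** (Y ** transpose O1)"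
      by (simp add: U_def matrix_diff_ldistrib matrix_mul_assoc)
    also have "\<dots> = U - (M ** Y) ** transpose O1"
      by (simp add: Ri_def matrix_inv_msqrt(1)[OF pd] matrix_mul_assoc)
    also have "M ** Y = W" by (simp add: W_def shrinkY_def M_def S l_def Let_def)
    finally show ?thesis .
  qed
  then have "real CARD('n) * real CARD('p) * loss Sig Th (ThetaG Sig g X)
      = (U - W ** transpose O1) \<bullet> (U - W ** transpose O1)"
    by (simp add: loss_eq_norm[OF pd] Ri_def)
  also have "\<dots> = U \<bullet> U - 2 * (U \<bullet> (W ** transpose O1)) + (W ** transpose O1) \<bullet> (W ** transpose O1)"
    by (simp add: inner_diff_left inner_diff_right inner_commute)
  also have "U \<bullet> (W ** transpose O1) = (U ** O1) \<bullet> W" by (simp add: inner_matrix_mult_right)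
  also have "U ** O1 = Y - Ri ** Th ** O1"
    by (simp add: U_def Y_def matrix_diff_ldistrib matrix_diff_rdistrib matrix_mul_assoc)
  also have "(W ** transpose O1) \<bullet> (W ** transpose O1) = W \<bullet> W"
    by (simp add: inner_matrix_mult_right matrix_mul_assoc[symmetric] orth)
  also have "W \<bullet> W = (\<Sum>i\<in>UNIV. l $ i * (g l $ i)\<^sup>2)"
    using shrinkY_norm[of g Y] by (simp add: W_def l_def S)
  also have "U \<bullet> U = real CARD('n) * real CARD('p) * loss Sig Th X"
    by (simp add: loss_eq_norm[OF pd] U_def Ri_def)
  finally show ?thesis by (simp add: inner_vec_def Y_def W_def)
qed

section \<open>Almost sure simplicity of the spectrum\<close>

text \<open>Up to a constant factor Lebesgue measure is its own image under an affine map with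
  nonzero \<open>c\<close>.\<close>

lemma AE_lborel_affine_vimage:
  fixes P :: "'a::euclidean_space \<Rightarrow> bool"
  assumes c: "c \<noteq> 0" and P: "Measurable.pred borel P" and ae: "AE x in lborel. P (t + c *\<^sub>R x)"
  shows "AE x in lborel. P x"
proof -
  have [measurable]: "Measurable.pred borel P" by (rule P)
  show ?thesis
    by (subst lborel_affine[OF c, of t]) (simp add: AE_density AE_distr_iff ae)
qed

text \<open>The line is not a null set, even without the point 0. That point has to be avoided since
  the value found here serves as the factor of a dilation.\<close>

lemma AE_lborel_nonzero_ex:
  assumes "AE s in lborel. P s"
  shows "\<exists>s::real. s \<noteq> 0 \<and> P s"
proof (rule ccontr)
  assume "\<not> ?thesis"
  then have *: "P s \<Longrightarrow> s = 0" for s by blast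
  have "AE s::real in lborel. s \<noteq> 0" by (rule AE_lborel_singleton)
  with assms have "AE s::real in lborel. False" by eventually_elim (use * in blast)
  then show False
    using AE_iff_measurable[of UNIV "lborel :: real measure" "\<lambda>_. False"] by simp
qed

text \<open>Every line through \<^term>\<open>x0\<close> meets the zero set in finitely many points, so by Tonelli
  some dilation about \<^term>\<open>x0\<close> maps a null set onto the zero set.\<close>
lemma AE_real_polynomial_function_nonzero:
  fixes f :: "'a::euclidean_space \<Rightarrow> real"
  assumes f: "real_polynomial_function f" and x0: "f x0 \<noteq> 0"
  shows "AE x in lborel. f x \<noteq> 0"
proof -
  have cont: "continuous_on UNIV f"
    using f continuous_real_polymonial_function by (metis continuous_at_imp_continuous_on)
  then have [measurable]: "f \<in> borel_measurable borel" by (rule borel_measurable_continuous_onI)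
  have line: "AE s in lborel. f (x0 + s *\<^sub>R (x - x0)) \<noteq> 0" for x
  proof -
    \<comment> \<open>The restriction of \<open>f\<close> to the line through \<open>x0\<close> and
      \<open>x\<close>; its value at 0 is \<open>f x0\<close>, so it is not the zero
      polynomial.\<close>
    define h where "h = f \<circ> (\<lambda>s. x0 + s *\<^sub>R (x - x0))"
    have "polynomial_function (\<lambda>s::real. x0 + s *\<^sub>R (x - x0))"
      by (rule polynomial_function_add[OF polynomial_function_const
            polynomial_function_bounded_linear[OF bounded_linear_scaleR_left]])
    then have "real_polynomial_function h"
      unfolding h_def by (rule real_polynomial_function_compose) (rule f)
    then obtain a n where h: "h = (\<lambda>s. \<Sum>i\<le>n. a i * s ^ i)"
      using real_polynomial_function_iff_sum by auto
    have "h 0 \<noteq> 0" using x0 by (simp add: h_def)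
    moreover have "h 0 = 0" if "\<forall>k\<le>n. a k = 0" using that by (simp add: h)
    ultimately obtain k where "a k \<noteq> 0" "k \<le> n" by blast
    then have "finite {s. h s = 0}" unfolding h by (rule polyfun_roots_finite)
    then have "{s. h s = 0} \<in> null_sets lborel" by (rule finite_imp_null_set_lborel)
    from AE_not_in[OF this] show ?thesis by (simp add: h_def)
  qed
  have "AE x in lborel. AE s in lborel. f (x0 + s *\<^sub>R (x - x0)) \<noteq> 0"
    by (rule AE_I2) (rule line)
  then have "AE s in lborel. AE x in lborel. f (x0 + s *\<^sub>R (x - x0)) \<noteq> 0"
    by (subst (asm) lborel_pair.AE_commute) measurable
  from AE_lborel_nonzero_ex[OF this] obtain s :: real where
    s: "s \<noteq> 0" "AE x in lborel. f (x0 + s *\<^sub>R (x - x0)) \<noteq> 0" by blast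
  show ?thesis
    by (rule AE_lborel_affine_vimage[OF s(1), where t = "x0 - s *\<^sub>R x0"])
       (measurable, use s(2) in \<open>simp add: algebra_simps\<close>)
qed

section \<open>Matrices with polynomial entries and the discriminant of a symmetric matrix\<close>

definition poly_matrix :: "('a::real_normed_vector \<Rightarrow> real^'n^'m) \<Rightarrow> bool" where
  "poly_matrix F \<longleftrightarrow> (\<forall>i j. real_polynomial_function (\<lambda>x. F x $ i $ j))"

lemma poly_matrix_const: "poly_matrix (\<lambda>x. C)"
  by (auto simp: poly_matrix_def)

lemma poly_matrix_id: "poly_matrix (\<lambda>X. X)"
  unfolding poly_matrix_def
  by (intro allI real_polynomial_function.intros(1) bounded_linear_compose[OF bounded_linear_vec_nth bounded_linear_vec_nth])

lemma poly_matrix_mult: "poly_matrix F \<Longrightarrow> poly_matrix G \<Longrightarrow> poly_matrix (\<lambda>x. F x ** G x)"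
  by (auto simp: poly_matrix_def matrix_mult_entry intro!: real_polynomial_function_sum)

lemma poly_matrix_transpose: "poly_matrix F \<Longrightarrow> poly_matrix (\<lambda>x. transpose (F x))"
  by (auto simp: poly_matrix_def transpose_def)

lemma real_polynomial_function_det:
  fixes F :: "'a::real_normed_vector \<Rightarrow> real^'n^'n"
  shows "poly_matrix F \<Longrightarrow> real_polynomial_function (\<lambda>x. det (F x))"
  unfolding det_def poly_matrix_def
  by (intro real_polynomial_function_sum real_polynomial_function.intros(4) real_polynomial_function.intros(2)
      real_polynomial_function_prod finite_permutations) auto

primrec matpow :: "real^'n^'n \<Rightarrow> nat \<Rightarrow> real^'n^'n" where
  "matpow S 0 = mat 1"
| "matpow S (Suc k) = S ** matpow S k"

lemma poly_matrix_matpow: "poly_matrix F \<Longrightarrow> poly_matrix (\<lambda>x. matpow (F x) k)"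
  by (induction k) (auto intro: poly_matrix_const poly_matrix_mult)

text \<open>Its determinant is polynomial in S and equals the squared Vandermonde determinant of the
  eigenvalues, hence serves as the discriminant.\<close>
definition hankel :: "real^('p::{finite,linorder})^('p::{finite,linorder}) \<Rightarrow> real^('p::{finite,linorder})^('p::{finite,linorder})" where
  "hankel S = (\<chi> i j. trace (matpow S (rank_of i + rank_of j)))"

definition vandermonde :: "real^('p::{finite,linorder}) \<Rightarrow> real^('p::{finite,linorder})^('p::{finite,linorder})" where
  "vandermonde l = (\<chi> i k. (l $ k) ^ rank_of i)"

lemma poly_matrix_hankel: "poly_matrix F \<Longrightarrow> poly_matrix (\<lambda>x. hankel (F x))"
  using poly_matrix_matpow[of F]
  by (auto simp: poly_matrix_def hankel_def trace_def intro!: real_polynomial_function_sum)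

lemma matpow_diag_conj:
  fixes H :: "real^'n^'n"
  assumes H: "orthogonal_matrix H"
  shows "matpow (H ** diag_mat l ** transpose H) k = H ** diag_mat (\<chi> i. l $ i ^ k) ** transpose H"
proof (induction k)
  case 0
  have "diag_mat (\<chi> i. (1 :: real)) = (mat 1 :: real^'n^'n)" by (simp add: diag_mat_def mat_def vec_eq_iff)
  then show ?case by (simp add: orthogonal_matrix_mult_transpose[OF H])
next
  case (Suc k)
  then show ?case by (simp add: diag_conj_mult[OF H])
qed

lemma trace_diag_conj:
  fixes H :: "real^'n^'n"
  assumes H: "orthogonal_matrix H"
  shows "trace (H ** diag_mat l ** transpose H) = (\<Sum>i\<in>UNIV. l $ i)"
proof -
  have "trace (H ** diag_mat l ** transpose H) = trace (transpose H ** H ** diag_mat l)"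
    by (subst trace_mul_sym) (simp only: matrix_mul_assoc)
  then show ?thesis
    by (simp add: orthogonal_matrix_mult_transpose[OF H]) (simp add: trace_def diag_mat_def)
qed

text \<open>The trace of the m-th power of \<open>S\<close> is the m-th power sum of the
  eigenvalues, and the exponent \<open>rank_of i + rank_of j\<close> splits each summand into two
  Vandermonde entries.\<close>

lemma hankel_eq_vandermonde:
  fixes H :: "real^('p::{finite,linorder})^('p::{finite,linorder})"
  assumes H: "orthogonal_matrix H" "S = H ** diag_mat l ** transpose H"
  shows "hankel S = vandermonde l ** transpose (vandermonde l)"
  unfolding hankel_def H(2) matpow_diag_conj[OF H(1)] trace_diag_conj[OF H(1)]
  by (simp add: vec_eq_iff matrix_mult_entry vandermonde_def transpose_def power_add)

lemma det_hankel_zero: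
  fixes H :: "real^('p::{finite,linorder})^('p::{finite,linorder})"
  assumes H: "orthogonal_matrix H" "S = H ** diag_mat l ** transpose H" and ij: "i \<noteq> j" "l $ i = l $ j"
  shows "det (hankel S) = 0"
proof -
  have "column i (vandermonde l) = column j (vandermonde l)"
    by (simp add: column_def vandermonde_def ij)
  then have "det (vandermonde l) = 0" using det_identical_columns ij(1) by blast
  then show ?thesis by (simp add: hankel_eq_vandermonde[OF H] det_mul)
qed

text \<open>A kernel vector of the transposed matrix lists the coefficients of a polynomial of
  degree at most p - 1 with p distinct roots, so it is zero.\<close>

lemma det_vandermonde_nonzero:
  fixes l :: "real^('p::{finite,linorder})"
  assumes inj: "inj (\<lambda>i. l $ i)"
  shows "det (vandermonde l) \<noteq> 0"
proof -
  have "x = 0" if x: "transpose (vandermonde l) *v x = 0" for x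
  proof (rule ccontr)
    assume "x \<noteq> 0"
    then obtain k where k: "x $ k \<noteq> 0" by (auto simp: vec_eq_iff)
    define n where "n = CARD('p) - 1"
    have rn: "rank_of i \<le> n" for i :: 'p using rank_of_less[of i] by (simp add: n_def)
    \<comment> \<open>The coefficients of that polynomial, renumbered by exponent; each sum has at
      most one nonzero term because \<open>rank_of\<close> is injective.\<close>
    define a where "a m = (\<Sum>i\<in>UNIV. if rank_of i = m then x $ i else 0)" for m
    have "a (rank_of k) = x $ k" by (simp add: a_def inj_eq[OF inj_rank_of])
    then have ak: "a (rank_of k) \<noteq> 0" using k by simp
    have eval: "(\<Sum>m\<le>n. a m * z ^ m) = (\<Sum>i\<in>UNIV. x $ i * z ^ rank_of i)" for z
    proof -
      have "(\<Sum>m\<le>n. a m * z ^ m) = (\<Sum>i\<in>UNIV. \<Sum>m\<le>n. (if rank_of i = m then x $ i else 0) * z ^ m)"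
        unfolding a_def sum_distrib_right by (rule sum.swap)
      also have "\<dots> = (\<Sum>i\<in>UNIV. x $ i * z ^ rank_of i)"
        by (rule sum.cong) (simp_all add: rn if_distrib[of "\<lambda>y. y * _"] cong: if_cong)
      finally show ?thesis .
    qed
    have "(\<Sum>i\<in>UNIV. x $ i * (l $ m) ^ rank_of i) = (transpose (vandermonde l) *v x) $ m" for m
      by (simp add: matrix_vector_mult_def transpose_def vandermonde_def mult.commute del: transpose_matrix_vector)
    then have roots: "range (\<lambda>i. l $ i) \<subseteq> {z. (\<Sum>m\<le>n. a m * z ^ m) = 0}"
      by (auto simp: eval x simp del: transpose_matrix_vector)
    have fin: "finite {z. (\<Sum>m\<le>n. a m * z ^ m) = 0}" and card: "card {z. (\<Sum>m\<le>n. a m * z ^ m) = 0} \<le> n"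
      using polyfun_roots_finite[of a, OF ak rn] polyfun_roots_card[of a, OF ak rn] by auto
    have "CARD('p) = card (range (\<lambda>i. l $ i))" by (simp add: card_image inj)
    also have "\<dots> \<le> n" using card_mono[OF fin roots] card by linarith
    finally show False using rank_of_less[of k] by (simp add: n_def)
  qed
  then have "invertible (transpose (vandermonde l))"
    using matrix_left_invertible_ker[of "transpose (vandermonde l)"] invertible_left_inverse by blast
  then show ?thesis by (simp add: invertible_det_nz)
qed

text \<open>An open Weyl chamber cut with the positive orthant. As an input abbreviation it is
  literally the set on which the theorem assumes \<open>g\<close> to be differentiable.\<close>

abbreviation (input) simple_pos_spectra :: "(real^('p::{finite,linorder})) set" where
  "simple_pos_spectra \<equiv> {l. (\<forall>i. 0 < l $ i) \<and> (\<forall>i j. i < j \<longrightarrow> l $ j < l $ i)}"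

text \<open>The Hankel determinant excludes coincidences among the sorted eigenvalues, and
  \<open>det S\<close> excludes the value zero; negative values are impossible for a Gram
  matrix.\<close>

lemma specL_simple_pos:
  fixes Y :: "real^'m^('p::{finite,linorder})"
  defines "S \<equiv> Y ** transpose Y"
  assumes nz: "det (hankel S) * det S \<noteq> 0"
  shows "specL S \<in> simple_pos_spectra"
proof -
  have sym: "transpose S = S" by (simp add: S_def matrix_transpose_mul)
  note H = spec_decomp(1,2)[OF sym]
  have "specL S $ j < specL S $ i" if "i < j" for i j
  proof -
    have "specL S $ j \<noteq> specL S $ i" using det_hankel_zero[OF H] that nz by force
    moreover have "specL S $ j \<le> specL S $ i" using spec_decomp(3)[OF sym, of i j] that by simp
    ultimately show ?thesis by linarith
  qed
  moreover have "0 < specL S $ i" for i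
  proof -
    have "specL S $ i = column i (specH S) \<bullet> (S *v column i (specH S))"
      by (rule eigenvalue_eq_quadratic_form(1)[OF H])
    also have "\<dots> = (transpose Y *v column i (specH S)) \<bullet> (transpose Y *v column i (specH S))"
      unfolding S_def by (simp add: matrix_vector_mul_assoc[symmetric] dot_lmul_matrix)
    finally have "0 \<le> specL S $ i" by simp
    moreover have "specL S $ i \<noteq> 0"
    proof
      assume "specL S $ i = 0"
      then have "S *v column i (specH S) = 0" using eigenvalue_eq_quadratic_form(2)[OF H] by simp
      moreover have "invertible S" using nz by (simp add: invertible_det_nz)
      ultimately show False
        using orthogonal_column_nonzero[OF H(1)] matrix_left_invertible_ker invertible_left_inverse by metis
    qed
    ultimately show ?thesis by linarith
  qed
  ultimately show ?thesis by blast
qed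

text \<open>An injection of rows into columns allows one entry per row, in distinct columns, so the
  Gram matrix is diagonal with any prescribed positive entries.\<close>

lemma exists_simple_pos_gram:
  assumes card: "CARD('p) \<le> CARD('m)"
  shows "\<exists>Y :: real^'m^('p::{finite,linorder}). det (hankel (Y ** transpose Y)) * det (Y ** transpose Y) \<noteq> 0"
proof -
  obtain s :: "'p \<Rightarrow> 'm" where s: "inj s"
    using card card_le_inj[of "UNIV :: 'p set" "UNIV :: 'm set"] by auto
  \<comment> \<open>The values 1, ..., p in some fixed order; the shift makes them positive, as
    \<open>rank_of\<close> starts at 0.\<close>
  define l :: "real^('p::{finite,linorder})" where "l = (\<chi> i. real (rank_of i) + 1)"
  define Y where "Y = (\<chi> (i::'p) (b::'m). if b = s i then sqrt (l $ i) else 0)"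
  have lpos: "l $ i > 0" for i by (simp add: l_def add_nonneg_pos)
  have "(Y ** transpose Y) $ i $ j = diag_mat l $ i $ j" for i j
  proof -
    have "(Y ** transpose Y) $ i $ j = (\<Sum>b\<in>UNIV. (if b = s i then sqrt (l $ i) * (if b = s j then sqrt (l $ j) else 0) else 0))"
      unfolding matrix_mult_entry by (rule sum.cong) (auto simp: transpose_def Y_def)
    also have "\<dots> = (if s i = s j then sqrt (l $ i) * sqrt (l $ j) else 0)" by simp
    finally show ?thesis using lpos by (simp add: diag_mat_def inj_eq[OF s] less_imp_le)
  qed
  then have S: "Y ** transpose Y = diag_mat l" by (simp add: vec_eq_iff)
  have "det (vandermonde l) \<noteq> 0"
    by (rule det_vandermonde_nonzero) (simp add: inj_def l_def inj_eq[OF inj_rank_of])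
  then have "det (hankel (diag_mat l)) \<noteq> 0"
    using hankel_eq_vandermonde[of "mat 1" "diag_mat l" l] by (simp add: orthogonal_matrix_id det_mul)
  moreover have "det (diag_mat l) = (\<Prod>i\<in>UNIV. l $ i)"
    by (subst det_diagonal) (auto simp: diag_mat_def)
  then have "det (diag_mat l) \<noteq> 0" using lpos by (simp add: less_imp_neq[THEN not_sym])
  ultimately show ?thesis by (intro exI[of _ Y]) (simp add: S)
qed

lemma AE_simple_pos_spectrum:
  fixes A :: "real^('p::{finite,linorder})^('p::{finite,linorder})" and O1 :: "real^'m^'n"
  assumes card: "CARD('p) \<le> CARD('m)" and A: "B ** A = mat 1" "A ** B = mat 1" and orth: "transpose O1 ** O1 = mat 1"
  shows "AE X in lborel. specL ((A ** X ** O1) ** transpose (A ** X ** O1)) \<in> simple_pos_spectra"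
proof -
  let ?Y = "\<lambda>X. A ** X ** O1"
  let ?f = "\<lambda>X. det (hankel (?Y X ** transpose (?Y X))) * det (?Y X ** transpose (?Y X))"
  obtain Y0 :: "real^'m^('p::{finite,linorder})" where Y0: "det (hankel (Y0 ** transpose Y0)) * det (Y0 ** transpose Y0) \<noteq> 0"
    using exists_simple_pos_gram[OF card] by blast
  \<comment> \<open>A preimage of the witness \<open>Y0\<close> under the map from X to Y: there the
    polynomial in X is nonzero.\<close>
  have "?Y (B ** Y0 ** transpose O1) = (A ** B) ** Y0 ** (transpose O1 ** O1)" by (simp add: matrix_mul_assoc)
  then have "?Y (B ** Y0 ** transpose O1) = Y0" by (simp add: A orth)
  then have nz: "?f (B ** Y0 ** transpose O1) \<noteq> 0" using Y0 by simp
  have "poly_matrix (\<lambda>X. ?Y X ** transpose (?Y X))"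
    by (intro poly_matrix_mult poly_matrix_transpose poly_matrix_const poly_matrix_id)
  then have "real_polynomial_function ?f"
    by (intro real_polynomial_function.intros(4) real_polynomial_function_det poly_matrix_hankel)
  from AE_real_polynomial_function_nonzero[OF this nz]
  show ?thesis by (rule AE_mp) (intro AE_I2 impI specL_simple_pos)
qed

section \<open>Perturbation of a simple spectrum\<close>

text \<open>The least index moved down would be sent to a smaller index which, by monotonicity, is
  again moved down; dually for the greatest index moved up.\<close>

lemma strict_mono_finite_eq_id:
  fixes s :: "'p::{finite,linorder} \<Rightarrow> 'p"
  assumes mono: "\<And>i j. i < j \<Longrightarrow> s i < s j"
  shows "s i = i"
proof -
  have "\<not> s i < i" for i
  proof
    assume "s i < i"
    define A where "A = {i. s i < i}"
    have A: "finite A" "A \<noteq> {}" using \<open>s i < i\<close> by (auto simp: A_def)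
    have "Min A \<in> A" using A by (rule Min_in)
    then have "s (Min A) \<in> A" using mono by (auto simp: A_def)
    moreover have "s (Min A) < Min A" using \<open>Min A \<in> A\<close> by (simp add: A_def)
    ultimately show False using Min_le[OF A(1)] leD by blast
  qed
  moreover have "\<not> i < s i" for i
  proof
    assume "i < s i"
    define A where "A = {i. i < s i}"
    have A: "finite A" "A \<noteq> {}" using \<open>i < s i\<close> by (auto simp: A_def)
    have "Max A \<in> A" using A by (rule Max_in)
    then have "s (Max A) \<in> A" using mono by (auto simp: A_def)
    moreover have "Max A < s (Max A)" using \<open>Max A \<in> A\<close> by (simp add: A_def)
    ultimately show False using Max_ge[OF A(1)] leD by blast
  qed
  ultimately show ?thesis by (meson linorder_neqE)
qed

lemma orthogonal_matrix_sums:
  fixes N :: "real^'n^'n"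
  assumes "orthogonal_matrix N"
  shows "(\<Sum>k\<in>UNIV. N $ k $ i * N $ k $ j) = (if i = j then 1 else 0)"
    "(\<Sum>k\<in>UNIV. N $ i $ k * N $ j $ k) = (if i = j then 1 else 0)"
    "\<bar>N $ i $ j\<bar> \<le> 1"
proof -
  have "(transpose N ** N) $ i $ j = mat 1 $ i $ j" "(N ** transpose N) $ i $ j = mat 1 $ i $ j"
    by (simp_all only: orthogonal_matrix_mult_transpose[OF assms])
  then show "(\<Sum>k\<in>UNIV. N $ k $ i * N $ k $ j) = (if i = j then 1 else 0)"
    "(\<Sum>k\<in>UNIV. N $ i $ k * N $ j $ k) = (if i = j then 1 else 0)"
    by (simp_all add: matrix_mult_entry transpose_def mat_def)
  have "norm (column j N) = 1" using assms orthogonal_matrix_orthonormal_columns by blast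
  then show "\<bar>N $ i $ j\<bar> \<le> 1" using component_le_norm_cart[of "column j N" i] by (simp add: column_def)
qed

text \<open>Every row of an orthogonal matrix has an entry of size at least 1/p, which pairs each
  eigenvalue with a nearby one; the pairing is strictly monotone, hence the identity.\<close>
lemma eigenvalues_close:
  fixes N :: "real^('p::{finite,linorder})^('p::{finite,linorder})"
  assumes orth: "orthogonal_matrix N" and dec: "\<And>i j. i \<le> j \<Longrightarrow> l $ j \<le> l $ i"
    and small: "\<And>i j. \<bar>(l $ j - l0 $ i) * N $ i $ j\<bar> \<le> e"
    and gap: "\<And>i j. i < j \<Longrightarrow> l0 $ j + 2 * real CARD('p) * e < l0 $ i"
  shows "\<bar>l $ i - l0 $ i\<bar> \<le> real CARD('p) * e"
proof -
  define p where "p = real CARD('p)"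
  have p: "p > 0" by (simp add: p_def)
  have "\<exists>j. \<bar>l $ j - l0 $ i\<bar> \<le> p * e" for i
  proof (rule ccontr)
    assume "\<not> ?thesis"
    then have big: "p * e < \<bar>l $ j - l0 $ i\<bar>" for j by (simp add: not_le)
    have "e \<ge> 0" using small[of i i] by linarith
    have "N $ i $ j * N $ i $ j < 1 / p" for j
    proof (cases "N $ i $ j = 0")
      case False
      then have "p * e * \<bar>N $ i $ j\<bar> < \<bar>l $ j - l0 $ i\<bar> * \<bar>N $ i $ j\<bar>" using big by simp
      also have "\<dots> \<le> e" using small[of j i] by (simp add: abs_mult)
      finally have *: "p * e * \<bar>N $ i $ j\<bar> < e" .
      then have "e > 0" using \<open>e \<ge> 0\<close> by (cases "e = 0") auto
      then have "p * \<bar>N $ i $ j\<bar> < 1" using * by (simp add: field_simps)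
      then have "\<bar>N $ i $ j\<bar> < 1 / p" using p by (simp add: field_simps)
      moreover have "N $ i $ j * N $ i $ j = \<bar>N $ i $ j\<bar> * \<bar>N $ i $ j\<bar>" by simp
      moreover have "\<bar>N $ i $ j\<bar> * \<bar>N $ i $ j\<bar> \<le> \<bar>N $ i $ j\<bar> * 1"
        using orthogonal_matrix_sums(3)[OF orth] by (intro mult_left_mono) auto
      ultimately show ?thesis by linarith
    qed (use p in simp)
    then have "(\<Sum>j\<in>UNIV. N $ i $ j * N $ i $ j) < (\<Sum>j\<in>(UNIV::'p set). 1 / p)"
      by (intro sum_strict_mono) auto
    then show False using orthogonal_matrix_sums(2)[OF orth, of i i] by (simp add: p_def)
  qed
  then obtain s where s: "\<And>i. \<bar>l $ s i - l0 $ i\<bar> \<le> p * e" by metis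
  \<comment> \<open>A pair in the wrong order would bring \<open>l0 $ i\<close> and
    \<open>l0 $ j\<close> within the sum of two errors \<open>p * e\<close>, which
    \<open>gap\<close> forbids.\<close>
  have "s i < s j" if "i < j" for i j
  proof (rule ccontr)
    assume "\<not> s i < s j"
    then have "l $ s i \<le> l $ s j" using dec by simp
    then show False using gap[OF that] s[of i] s[of j] unfolding p_def[symmetric] by linarith
  qed
  then have "s i = i" for i by (rule strict_mono_finite_eq_id)
  with s show ?thesis by (metis p_def)
qed

text \<open>The eigenvector matrix \<open>N t\<close> need not be continuous: each column is determined up to sign only.
  Products of two entries of the same column do not see the sign and are differentiable at 0.\<close>
locale eigen_perturbation =
  fixes l0 :: "real^('p::{finite,linorder})" and T1 T2 :: "real^('p::{finite,linorder})^('p::{finite,linorder})"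
    and N :: "real \<Rightarrow> real^('p::{finite,linorder})^('p::{finite,linorder})" and l :: "real \<Rightarrow> real^('p::{finite,linorder})"
  assumes simple: "\<And>i j. i < j \<Longrightarrow> l0 $ j < l0 $ i"
    and orth: "\<And>t. orthogonal_matrix (N t)"
    and eig: "\<And>t. diag_mat l0 + t *\<^sub>R T1 + t\<^sup>2 *\<^sub>R T2 = N t ** diag_mat (l t) ** transpose (N t)"
    and dec: "\<And>t i j. i \<le> j \<Longrightarrow> l t $ j \<le> l t $ i"
begin

text \<open>Entry (i, k) of the orthogonal projection onto the j-th perturbed eigenline; the
  eigenvalue index comes first.\<close>

definition q :: "'p \<Rightarrow> 'p \<Rightarrow> 'p \<Rightarrow> real \<Rightarrow> real" where
  "q j i k t = N t $ i $ j * N t $ k $ j"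

lemma simple_neq: "i \<noteq> j \<Longrightarrow> l0 $ i \<noteq> l0 $ j"
  using simple[of i j] simple[of j i] by (cases "i < j") force+

text \<open>One entry of the eigenvalue equation, with the unperturbed diagonal moved to the left.
  For distinct i and j the gap on the left stays away from 0 near t = 0 and can be divided
  out.\<close>

lemma eigen_entry: "(l t $ j - l0 $ i) * N t $ i $ j = t * (\<Sum>m\<in>UNIV. (T1 $ i $ m + t * T2 $ i $ m) * N t $ m $ j)"
proof -
  have "(diag_mat l0 + t *\<^sub>R T1 + t\<^sup>2 *\<^sub>R T2) ** N t = N t ** diag_mat (l t)"
    unfolding eig by (simp add: matrix_mul_assoc[symmetric] orthogonal_matrix_mult_transpose[OF orth])
  then have "((diag_mat l0 + t *\<^sub>R T1 + t\<^sup>2 *\<^sub>R T2) ** N t) $ i $ j = N t $ i $ j * l t $ j"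
    by (simp add: matrix_mult_diag_entry)
  moreover have "((diag_mat l0 + t *\<^sub>R T1 + t\<^sup>2 *\<^sub>R T2) ** N t) $ i $ j
    = (\<Sum>m\<in>UNIV. diag_mat l0 $ i $ m * N t $ m $ j) + t * (\<Sum>m\<in>UNIV. (T1 $ i $ m + t * T2 $ i $ m) * N t $ m $ j)"
    by (simp add: matrix_mult_entry sum_distrib_left sum.distrib[symmetric] algebra_simps power2_eq_square)
  moreover have "(\<Sum>m\<in>UNIV. diag_mat l0 $ i $ m * N t $ m $ j) = l0 $ i * N t $ i $ j"
    by (simp add: diag_mat_def if_distrib[of "\<lambda>x. x * _"] cong: if_cong)
  ultimately show ?thesis by (simp add: algebra_simps)
qed

lemma q_eq: "(l t $ j - l0 $ i) * q j i k t = t * (\<Sum>m\<in>UNIV. (T1 $ i $ m + t * T2 $ i $ m) * q j m k t)"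
proof -
  have "(l t $ j - l0 $ i) * q j i k t = t * (\<Sum>m\<in>UNIV. (T1 $ i $ m + t * T2 $ i $ m) * N t $ m $ j) * N t $ k $ j"
    by (simp only: q_def mult.assoc[symmetric] eigen_entry)
  then show ?thesis by (simp only: q_def mult.assoc sum_distrib_right)
qed

lemma q_commute: "q j i k = q j k i"
  by (simp add: q_def fun_eq_iff mult.commute)

definition K :: real where
  "K = (\<Sum>i\<in>UNIV. \<Sum>m\<in>UNIV. \<bar>T1 $ i $ m\<bar> + \<bar>T2 $ i $ m\<bar>)"

lemma eigen_entry_bound:
  assumes t: "\<bar>t\<bar> \<le> 1"
  shows "\<bar>(l t $ j - l0 $ i) * N t $ i $ j\<bar> \<le> K * \<bar>t\<bar>"
proof -
  have "\<bar>\<Sum>m\<in>UNIV. (T1 $ i $ m + t * T2 $ i $ m) * N t $ m $ j\<bar>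
      \<le> (\<Sum>m\<in>UNIV. \<bar>T1 $ i $ m\<bar> + \<bar>T2 $ i $ m\<bar>)"
  proof (rule order_trans[OF sum_abs sum_mono])
    fix m :: 'p
    have "\<bar>t * T2 $ i $ m\<bar> \<le> \<bar>T2 $ i $ m\<bar>" using t by (simp add: abs_mult mult_left_le_one_le)
    then have 1: "\<bar>T1 $ i $ m + t * T2 $ i $ m\<bar> \<le> \<bar>T1 $ i $ m\<bar> + \<bar>T2 $ i $ m\<bar>" by linarith
    have "\<bar>(T1 $ i $ m + t * T2 $ i $ m) * N t $ m $ j\<bar> \<le> \<bar>T1 $ i $ m + t * T2 $ i $ m\<bar> * 1"
      unfolding abs_mult by (intro mult_left_mono orthogonal_matrix_sums(3)[OF orth]) simp
    then show "\<bar>(T1 $ i $ m + t * T2 $ i $ m) * N t $ m $ j\<bar> \<le> \<bar>T1 $ i $ m\<bar> + \<bar>T2 $ i $ m\<bar>"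
      using 1 by simp
  qed
  also have "\<dots> \<le> K" unfolding K_def
    by (rule member_le_sum) (auto intro!: sum_nonneg add_nonneg_nonneg)
  finally show ?thesis unfolding eigen_entry abs_mult
    by (subst mult.commute) (simp add: mult_right_mono)
qed

text \<open>The error \<open>K * \<bar>t\<bar>\<close> is eventually small against all gaps of
  \<open>l0\<close>, so perturbed and unperturbed eigenvalues can be matched. With
  \<open>nhds 0\<close> in place of \<open>at 0\<close> the point t = 0 is included, and
  \<open>l 0 = l0\<close> can be read off.\<close>

lemma eigenvalue_bound:
  "\<forall>\<^sub>F t in nhds 0. \<bar>l t $ j - l0 $ j\<bar> \<le> real CARD('p) * (K * \<bar>t\<bar>)"
proof -
  have id: "((\<lambda>t. t) \<longlongrightarrow> (0::real)) (nhds 0)" by (rule filterlim_ident)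
  have "\<forall>\<^sub>F t in nhds 0. \<bar>t\<bar> < (1::real)"
    by (rule order_tendstoD(2)[OF tendsto_rabs[OF id]]) simp
  moreover have "\<forall>\<^sub>F t in nhds 0. \<forall>i j. i < j \<longrightarrow> l0 $ j + 2 * real CARD('p) * (K * \<bar>t\<bar>) < l0 $ i"
  proof (intro eventually_all_finite)
    fix i j :: 'p
    show "\<forall>\<^sub>F t in nhds 0. i < j \<longrightarrow> l0 $ j + 2 * real CARD('p) * (K * \<bar>t\<bar>) < l0 $ i"
    proof (cases "i < j")
      case True
      have "((\<lambda>t. l0 $ j + 2 * real CARD('p) * (K * \<bar>t\<bar>)) \<longlongrightarrow> l0 $ j + 2 * real CARD('p) * (K * \<bar>0\<bar>)) (nhds 0)"
        by (intro tendsto_intros id)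
      then have "((\<lambda>t. l0 $ j + 2 * real CARD('p) * (K * \<bar>t\<bar>)) \<longlongrightarrow> l0 $ j) (nhds 0)" by simp
      from order_tendstoD(2)[OF this simple[OF True]] show ?thesis by eventually_elim simp
    qed simp
  qed
  ultimately show ?thesis
  proof eventually_elim
    case (elim t)
    show ?case
      by (rule eigenvalues_close[OF orth dec eigen_entry_bound]) (use elim in auto)
  qed
qed

lemma l_zero: "l 0 = l0"
  using eventually_nhds_x_imp_x[OF eigenvalue_bound] by (simp add: vec_eq_iff)

lemma N_zero: "i \<noteq> j \<Longrightarrow> N 0 $ i $ j = 0"
  using eigen_entry[of 0 j i] simple_neq[of i j] by (simp add: l_zero)

lemma l_tendsto: "((\<lambda>t. l t $ j) \<longlongrightarrow> l0 $ j) (at 0)"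
proof -
  have "((\<lambda>t. l t $ j - l0 $ j) \<longlongrightarrow> 0) (at 0)"
  proof (rule Lim_null_comparison)
    show "\<forall>\<^sub>F t in at 0. norm (l t $ j - l0 $ j) \<le> real CARD('p) * (K * \<bar>t\<bar>)"
      using eigenvalue_bound[of j] by (simp add: eventually_at_filter eventually_mono)
    show "((\<lambda>t. real CARD('p) * (K * \<bar>t\<bar>)) \<longlongrightarrow> 0) (at 0)"
      by (intro tendsto_eq_intros) auto
  qed
  then show ?thesis by (simp add: LIM_zero_iff)
qed

lemma l_diff_nonzero:
  assumes "i \<noteq> j"
  shows "\<forall>\<^sub>F t in at 0. l t $ j - l0 $ i \<noteq> 0"
proof -
  have "((\<lambda>t. l t $ j - l0 $ i) \<longlongrightarrow> l0 $ j - l0 $ i) (at 0)" by (intro tendsto_intros l_tendsto)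
  then show ?thesis by (rule tendsto_imp_eventually_ne) (use simple_neq assms in force)
qed

section \<open>First-order expansion of spectral projections and eigenvalues\<close>

lemma q_sum_bound:
  assumes t: "\<bar>t\<bar> \<le> 1"
  shows "\<bar>(l t $ j - l0 $ i) * q j i k t\<bar> \<le> K * \<bar>t\<bar>"
proof -
  have "\<bar>(l t $ j - l0 $ i) * q j i k t\<bar> = \<bar>(l t $ j - l0 $ i) * N t $ i $ j\<bar> * \<bar>N t $ k $ j\<bar>"
    by (simp add: q_def abs_mult)
  also have "\<dots> \<le> (K * \<bar>t\<bar>) * 1"
    by (intro mult_mono eigen_entry_bound t orthogonal_matrix_sums(3)[OF orth]) (use eigen_entry_bound[OF t] abs_ge_zero order_trans in blast)+
  finally show ?thesis by simp
qed

lemma q_tendsto_0: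
  assumes "i \<noteq> j"
  shows "((\<lambda>t. q j i k t) \<longlongrightarrow> 0) (at 0)"
proof -
  have "((\<lambda>t. (l t $ j - l0 $ i) * q j i k t) \<longlongrightarrow> 0) (at 0)"
  proof (rule Lim_null_comparison)
    have "\<forall>\<^sub>F t in at 0. \<bar>t\<bar> < (1::real)"
      by (intro order_tendstoD(2)[where y=0] tendsto_eq_intros) auto
    then show "\<forall>\<^sub>F t in at 0. norm ((l t $ j - l0 $ i) * q j i k t) \<le> K * \<bar>t\<bar>"
      by eventually_elim (simp only: real_norm_def, rule q_sum_bound, simp)
    show "((\<lambda>t. K * \<bar>t\<bar>) \<longlongrightarrow> 0) (at 0)" by (intro tendsto_eq_intros) auto
  qed
  moreover have "((\<lambda>t. l t $ j - l0 $ i) \<longlongrightarrow> l0 $ j - l0 $ i) (at 0)" by (intro tendsto_intros l_tendsto)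
  ultimately have "((\<lambda>t. ((l t $ j - l0 $ i) * q j i k t) / (l t $ j - l0 $ i)) \<longlongrightarrow> 0 / (l0 $ j - l0 $ i)) (at 0)"
    using simple_neq[OF assms] by (intro tendsto_divide) auto
  then show ?thesis using l_diff_nonzero[OF assms]
    by (simp, elim Lim_transform_eventually) (auto elim: eventually_mono)
qed

lemma q_sum: "(\<Sum>i\<in>UNIV. q j i i t) = 1"
  using orthogonal_matrix_sums(1)[OF orth, of t j j] by (simp add: q_def)

text \<open>For i = j the gap in \<open>q_eq\<close> tends to 0 and cannot be divided out; this
  entry is recovered from the trace of a rank one projection.\<close>

lemma q_diag: "q j j j t = 1 - (\<Sum>i\<in>UNIV - {j}. q j i i t)"
  using q_sum[of j t] by (simp add: sum.remove[of UNIV j])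

lemma q_tendsto: "((\<lambda>t. q j i k t) \<longlongrightarrow> (if i = j \<and> k = j then 1 else 0)) (at 0)"
proof -
  consider "i \<noteq> j" | "i = j" "k \<noteq> j" | "i = j" "k = j" by blast
  then show ?thesis
  proof cases
    case 3
    have "((\<lambda>t. 1 - (\<Sum>i\<in>UNIV - {j}. q j i i t)) \<longlongrightarrow> 1 - (\<Sum>i\<in>UNIV - {j}. 0)) (at 0)"
      by (intro tendsto_intros q_tendsto_0) auto
    then show ?thesis by (simp add: 3 q_diag)
  next
    case 2
    then show ?thesis using q_tendsto_0[of k j i] by (simp add: q_commute[of j j k])
  qed (use q_tendsto_0 in simp)
qed

lemma q_sum_tendsto:
  "((\<lambda>t. \<Sum>m\<in>UNIV. (T1 $ i $ m + t * T2 $ i $ m) * q j m k t) \<longlongrightarrow> (if k = j then T1 $ i $ j else 0)) (at 0)"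
proof -
  have "((\<lambda>t. \<Sum>m\<in>UNIV. (T1 $ i $ m + t * T2 $ i $ m) * q j m k t)
      \<longlongrightarrow> (\<Sum>m\<in>UNIV. (T1 $ i $ m + 0 * T2 $ i $ m) * (if m = j \<and> k = j then 1 else 0))) (at 0)"
    by (intro tendsto_intros q_tendsto)
  also have "(\<Sum>m\<in>UNIV. (T1 $ i $ m + 0 * T2 $ i $ m) * (if m = j \<and> k = j then 1 else 0)) = (if k = j then T1 $ i $ j else 0)"
    by (cases "k = j") (simp_all add: if_distrib[of "\<lambda>x. _ * x"] cong: if_cong)
  finally show ?thesis .
qed

lemma q_zero: "q j i k 0 = (if i = j \<and> k = j then 1 else 0)"
proof -
  have off: "q j i k 0 = 0" if "i \<noteq> j \<or> k \<noteq> j" for i k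
    using that N_zero by (auto simp: q_def)
  have "q j j j 0 = 1" by (simp add: q_diag off)
  then show ?thesis using off by auto
qed

lemma q_offdiag_quotient:
  assumes "i \<noteq> j"
  shows "((\<lambda>t. q j i k t / t) \<longlongrightarrow> (if k = j then T1 $ i $ j / (l0 $ j - l0 $ i) else 0)) (at 0)"
proof -
  have "((\<lambda>t. (\<Sum>m\<in>UNIV. (T1 $ i $ m + t * T2 $ i $ m) * q j m k t) / (l t $ j - l0 $ i))
     \<longlongrightarrow> (if k = j then T1 $ i $ j else 0) / (l0 $ j - l0 $ i)) (at 0)"
    by (intro tendsto_divide q_sum_tendsto tendsto_diff l_tendsto tendsto_const) (use simple_neq assms in force)
  moreover have "\<forall>\<^sub>F t in at 0. (\<Sum>m\<in>UNIV. (T1 $ i $ m + t * T2 $ i $ m) * q j m k t) / (l t $ j - l0 $ i) = q j i k t / t"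
    using l_diff_nonzero[OF assms] eventually_neq_at_within[of 0 0 UNIV]
  proof eventually_elim
    case (elim t)
    then show ?case using q_eq[of t j i k] by (simp add: frac_eq_eq mult.commute)
  qed
  ultimately have "((\<lambda>t. q j i k t / t) \<longlongrightarrow> (if k = j then T1 $ i $ j else 0) / (l0 $ j - l0 $ i)) (at 0)"
    by (rule Lim_transform_eventually)
  then show ?thesis by (simp split: if_splits)
qed

text \<open>The classical first-order change of a spectral projection: only row j and column j move,
  and the whole diagonal is stationary.\<close>

definition q' :: "'p \<Rightarrow> 'p \<Rightarrow> 'p \<Rightarrow> real" where
  "q' j i k = (if i = j then (if k = j then 0 else T1 $ k $ j / (l0 $ j - l0 $ k))
               else if k = j then T1 $ i $ j / (l0 $ j - l0 $ i) else 0)"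

lemma q_has_derivative: "((\<lambda>t. q j i k t) has_real_derivative q' j i k) (at 0)"
proof -
  have off: "((\<lambda>t. q j i k t) has_real_derivative q' j i k) (at 0)" if "i \<noteq> j" for i k
    using q_offdiag_quotient[OF that, of k] that
    by (simp add: DERIV_def q_zero q'_def)
  consider "i \<noteq> j" | "i = j" "k \<noteq> j" | "i = j" "k = j" by blast
  then show ?thesis
  proof cases
    case 3
    have "((\<lambda>t. 1 - (\<Sum>i\<in>UNIV - {j}. q j i i t)) has_real_derivative 0 - (\<Sum>i\<in>UNIV - {j}. q' j i i)) (at 0)"
      by (intro derivative_intros off) auto
    then show ?thesis by (simp add: 3 q_diag q'_def)
  next
    case 2
    then show ?thesis using off[of k i] by (simp add: q_commute[of j j k] q'_def)
  qed (rule off)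
qed

text \<open>The Hellmann-Feynman formula: \<open>q_eq\<close> with i = k = j, divided by t and by
  \<open>q j j j\<close>, which tends to 1, isolates the difference quotient.\<close>

lemma l_has_derivative: "((\<lambda>t. l t $ j) has_real_derivative T1 $ j $ j) (at 0)"
proof -
  have "((\<lambda>t. (\<Sum>m\<in>UNIV. (T1 $ j $ m + t * T2 $ j $ m) * q j m j t) / q j j j t) \<longlongrightarrow> T1 $ j $ j / 1) (at 0)"
    by (intro tendsto_divide) (use q_sum_tendsto[of j j j] q_tendsto[of j j j] in auto)
  moreover have "\<forall>\<^sub>F t in at 0. q j j j t \<noteq> 0"
    using q_tendsto[of j j j] by (intro tendsto_imp_eventually_ne) auto
  then have "\<forall>\<^sub>F t in at 0. (\<Sum>m\<in>UNIV. (T1 $ j $ m + t * T2 $ j $ m) * q j m j t) / q j j j t = (l t $ j - l0 $ j) / t"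
    using eventually_neq_at_within[of 0 0 UNIV]
  proof eventually_elim
    case (elim t)
    then show ?case using q_eq[of t j j j] by (simp add: frac_eq_eq mult.commute)
  qed
  ultimately have "((\<lambda>t. (l t $ j - l0 $ j) / t) \<longlongrightarrow> T1 $ j $ j / 1) (at 0)"
    by (rule Lim_transform_eventually)
  then show ?thesis by (simp add: DERIV_def l_zero)
qed

lemma l_vec_has_derivative: "(l has_derivative (\<lambda>t. t *\<^sub>R (\<chi> j. T1 $ j $ j))) (at 0)"
proof (subst has_derivative_componentwise_within, intro ballI)
  fix b :: "(real, 'p) vec" assume "b \<in> Basis"
  then obtain j where b: "b = axis j 1" by (auto simp: Basis_vec_def)
  show "((\<lambda>t. l t \<bullet> b) has_derivative (\<lambda>t. (t *\<^sub>R (\<chi> j. T1 $ j $ j)) \<bullet> b)) (at 0)"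
    using l_has_derivative[of j]
    by (simp add: b inner_axis has_field_derivative_def mult_commute_abs)
qed

text \<open>The matrix is the sum over j of g_j times the j-th projection. On the diagonal the
  projections are stationary and only \<open>g\<close> varies. Off the diagonal they vanish at 0, so
  only the derivatives of projections i and k contribute, and by \<open>sym\<close> the two terms
  merge into a divided difference.\<close>

lemma diag_conj_has_derivative:
  assumes g: "(g has_derivative g') (at l0)" and sym: "T1 $ k $ i = T1 $ i $ k"
  shows "((\<lambda>t. (N t ** diag_mat (g (l t)) ** transpose (N t)) $ i $ k) has_real_derivative
     (if i = k then g' (\<chi> j. T1 $ j $ j) $ i else T1 $ i $ k * ((g l0 $ i - g l0 $ k) / (l0 $ i - l0 $ k)))) (at 0)"
proof -
  have "((g \<circ> l) has_derivative (g' \<circ> (\<lambda>t. t *\<^sub>R (\<chi> j. T1 $ j $ j)))) (at 0)"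
    by (rule diff_chain_at[OF l_vec_has_derivative]) (simp add: l_zero g)
  then have "((\<lambda>t. g (l t) $ j) has_derivative (\<lambda>t. g' (t *\<^sub>R (\<chi> j. T1 $ j $ j)) $ j)) (at 0)" for j
    unfolding o_def by (rule bounded_linear.has_derivative[OF bounded_linear_vec_nth])
  then have gl: "((\<lambda>t. g (l t) $ j) has_real_derivative g' (\<chi> j. T1 $ j $ j) $ j) (at 0)" for j
    using linear_scale[OF has_derivative_linear[OF g]]
    by (simp add: has_field_derivative_def mult_commute_abs)
  have entry: "(N t ** diag_mat (g (l t)) ** transpose (N t)) $ i $ k = (\<Sum>j\<in>UNIV. g (l t) $ j * q j i k t)" for t
    by (simp add: diag_conj_entry transpose_def q_def mult_ac)
  have "((\<lambda>t. \<Sum>j\<in>UNIV. g (l t) $ j * q j i k t) has_real_derivative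
     (\<Sum>j\<in>UNIV. g' (\<chi> j. T1 $ j $ j) $ j * q j i k 0 + q' j i k * g (l 0) $ j)) (at 0)"
    by (intro DERIV_sum DERIV_mult gl q_has_derivative)
  also have "(\<Sum>j\<in>UNIV. g' (\<chi> j. T1 $ j $ j) $ j * q j i k 0 + q' j i k * g (l 0) $ j)
    = (if i = k then g' (\<chi> j. T1 $ j $ j) $ i else T1 $ i $ k * ((g l0 $ i - g l0 $ k) / (l0 $ i - l0 $ k)))"
  proof (cases "i = k")
    case True
    have "g' (\<chi> j. T1 $ j $ j) $ j * q j i k 0 + q' j i k * g (l 0) $ j = (if j = i then g' (\<chi> j. T1 $ j $ j) $ i else 0)" for j
      by (auto simp: True q_zero q'_def)
    then show ?thesis by (simp add: True)
  next
    case False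
    have "g' (\<chi> j. T1 $ j $ j) $ j * q j i k 0 + q' j i k * g (l 0) $ j
      = (if j = i then T1 $ k $ i / (l0 $ i - l0 $ k) * g l0 $ i else 0)
        + (if j = k then T1 $ i $ k / (l0 $ k - l0 $ i) * g l0 $ k else 0)" for j
      using False by (auto simp: q_zero q'_def l_zero)
    then have "(\<Sum>j\<in>UNIV. g' (\<chi> j. T1 $ j $ j) $ j * q j i k 0 + q' j i k * g (l 0) $ j)
      = T1 $ k $ i / (l0 $ i - l0 $ k) * g l0 $ i + T1 $ i $ k / (l0 $ k - l0 $ i) * g l0 $ k"
      by (simp add: sum.distrib)
    also have "\<dots> = T1 $ i $ k * ((g l0 $ i - g l0 $ k) / (l0 $ i - l0 $ k))"
    proof -
      have "T1 $ i $ k / (l0 $ k - l0 $ i) = - (T1 $ i $ k / (l0 $ i - l0 $ k))"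
        by (metis minus_diff_eq minus_divide_right)
      then show ?thesis by (simp add: sym algebra_simps diff_divide_distrib)
    qed
    finally show ?thesis using False by simp
  qed
  finally show ?thesis by (simp only: entry)
qed

end

section \<open>Divergence of the shrinkage map\<close>

lemma scaleR_matrix_mult_right: "A ** (c *\<^sub>R B) = c *\<^sub>R (A ** B)" for A :: "real^'n^'m"
  by (simp add: vec_eq_iff matrix_mult_entry sum_distrib_left mult_ac)

lemma transpose_entry: "transpose A $ i $ j = A $ j $ i"
  by (simp add: transpose_def)

text \<open>In the frame \<open>H\<close> of the unperturbed Gram matrix the perturbed one is a
  diagonal matrix plus terms of degree one and two in t, as the locale requires. The product rule
  gives the change of H G H^T in the first sum and that of Y in the second.\<close>

lemma shrinkY_has_derivative:
  fixes Y E :: "real^'m^('p::{finite,linorder})"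
    and g :: "real^('p::{finite,linorder}) \<Rightarrow> real^('p::{finite,linorder})"
  defines "H \<equiv> specH (Y ** transpose Y)" and "l \<equiv> specL (Y ** transpose Y)"
  defines "Z \<equiv> transpose H ** Y" and "V \<equiv> transpose H ** E"
  assumes l: "l \<in> simple_pos_spectra" and g: "(g has_derivative g') (at l)"
  shows "((\<lambda>t. shrinkY g (Y + t *\<^sub>R E) $ a $ b) has_real_derivative
    (\<Sum>i\<in>UNIV. \<Sum>j\<in>UNIV. H $ a $ i * Z $ j $ b *
        (if i = j then g' (\<chi> k. 2 * (V ** transpose Z) $ k $ k) $ i
         else ((V ** transpose Z) $ i $ j + (V ** transpose Z) $ j $ i) * ((g l $ i - g l $ j) / (l $ i - l $ j))))
    + (\<Sum>i\<in>UNIV. H $ a $ i * g l $ i * V $ i $ b)) (at 0)"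
proof -
  define S where "S t = (Y + t *\<^sub>R E) ** transpose (Y + t *\<^sub>R E)" for t
  have sym: "transpose (S t) = S t" for t by (simp add: S_def matrix_transpose_mul)
  have S0: "S 0 = Y ** transpose Y" by (simp add: S_def)
  note spec0 = spec_decomp[OF sym[of 0], unfolded S0, folded H_def l_def]
  note HH = orthogonal_matrix_mult_transpose[OF spec0(1)]
  \<comment> \<open>Perturbed eigenvectors in the unperturbed frame; they inherit the arbitrariness
    of the choice at every t.\<close>
  define N where "N t = transpose H ** specH (S t)" for t
  define L where "L t = specL (S t)" for t
  define T1 where "T1 = V ** transpose Z + Z ** transpose V"
  define T2 where "T2 = V ** transpose V"
  have ZZ: "Z ** transpose Z = diag_mat l"
    using orthogonal_conj_cancel[OF spec0(1,2)] by (simp add: Z_def matrix_transpose_mul matrix_mul_assoc)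
  have HN: "H ** N t = specH (S t)" for t
    by (simp add: N_def matrix_mul_assoc HH)
  interpret eigen_perturbation l T1 T2 N L
  proof
    show "l $ j < l $ i" if "i < j" for i j using l that by blast
    show "orthogonal_matrix (N t)" for t
      unfolding N_def by (intro orthogonal_matrix_mul spec_decomp(1) sym) (simp add: spec0(1))
    show "L t $ j \<le> L t $ i" if "i \<le> j" for t i j
      unfolding L_def by (rule spec_decomp(3)[OF sym that])
    show "diag_mat l + t *\<^sub>R T1 + t\<^sup>2 *\<^sub>R T2 = N t ** diag_mat (L t) ** transpose (N t)" for t
    proof -
      have "N t ** diag_mat (L t) ** transpose (N t)
          = transpose H ** (specH (S t) ** diag_mat (L t) ** transpose (specH (S t))) ** H"
        by (simp add: N_def matrix_transpose_mul matrix_mul_assoc)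
      also have "specH (S t) ** diag_mat (L t) ** transpose (specH (S t)) = S t"
        using spec_decomp(2)[OF sym, of t] by (simp add: L_def)
      also have "transpose H ** S t ** H = (Z + t *\<^sub>R V) ** transpose (Z + t *\<^sub>R V)"
      proof -
        have "Z + t *\<^sub>R V = transpose H ** (Y + t *\<^sub>R E)"
          by (simp add: Z_def V_def matrix_add_ldistrib scaleR_matrix_mult_right)
        then show ?thesis by (simp add: S_def matrix_transpose_mul matrix_mul_assoc)
      qed
      also have "\<dots> = Z ** transpose Z + t *\<^sub>R T1 + t\<^sup>2 *\<^sub>R T2"
        by (simp add: vec_eq_iff matrix_mult_entry transpose_def T1_def T2_def sum_distrib_left
            sum.distrib[symmetric] algebra_simps power2_eq_square)
      finally show ?thesis by (simp add: ZZ)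
    qed
  qed
  let ?P = "\<lambda>t. N t ** diag_mat (g (L t)) ** transpose (N t)"
  let ?P' = "\<lambda>i j. if i = j then g' (\<chi> k. T1 $ k $ k) $ i else T1 $ i $ j * ((g l $ i - g l $ j) / (l $ i - l $ j))"
  have T1_entry: "T1 $ i $ j = (V ** transpose Z) $ i $ j + (V ** transpose Z) $ j $ i" for i j
    by (simp add: T1_def matrix_mult_entry transpose_def mult.commute)
  have P: "((\<lambda>t. ?P t $ i $ j) has_real_derivative ?P' i j) (at 0)" for i j
    by (rule diag_conj_has_derivative[OF g]) (simp add: T1_entry)
  have P0: "?P 0 $ i $ j = (if i = j then g l $ i else 0)" for i j
  proof -
    have "?P 0 $ i $ j = (\<Sum>k\<in>UNIV. q k i j 0 * g l $ k)"
      by (simp add: diag_conj_entry transpose_def q_def l_zero mult_ac)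
    also have "\<dots> = (\<Sum>k\<in>UNIV. if k = i then (if i = j then g l $ i else 0) else 0)"
      by (rule sum.cong) (auto simp: q_zero)
    finally show ?thesis by simp
  qed
  have shr: "shrinkY g (Y + t *\<^sub>R E) = H ** ?P t ** (Z + t *\<^sub>R V)" for t
  proof -
    have "Z + t *\<^sub>R V = transpose H ** (Y + t *\<^sub>R E)"
      by (simp add: Z_def V_def matrix_add_ldistrib scaleR_matrix_mult_right)
    then have "H ** ?P t ** (Z + t *\<^sub>R V) = (H ** N t) ** diag_mat (g (L t)) ** transpose (H ** N t) ** (Y + t *\<^sub>R E)"
      by (simp add: matrix_transpose_mul matrix_mul_assoc)
    then show ?thesis by (simp add: HN shrinkY_def S_def[symmetric] L_def Let_def)
  qed
  have ent: "shrinkY g (Y + t *\<^sub>R E) $ a $ b = (\<Sum>i\<in>UNIV. \<Sum>j\<in>UNIV. H $ a $ i * (?P t $ i $ j * (Z $ j $ b + t * V $ j $ b)))" for t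
  proof -
    have "shrinkY g (Y + t *\<^sub>R E) = H ** (?P t ** (Z + t *\<^sub>R V))" by (simp only: shr matrix_mul_assoc)
    then show ?thesis
      by (simp add: matrix_mult_entry[of H] matrix_mult_entry[of "?P t"] sum_distrib_left)
  qed
  have lin: "((\<lambda>t. z + t * v) has_real_derivative v) (at 0)" for z v :: real
    by (auto intro!: derivative_eq_intros)
  have "((\<lambda>t. \<Sum>i\<in>UNIV. \<Sum>j\<in>UNIV. H $ a $ i * (?P t $ i $ j * (Z $ j $ b + t * V $ j $ b))) has_real_derivative
      (\<Sum>i\<in>UNIV. \<Sum>j\<in>UNIV. H $ a $ i * (?P' i j * (Z $ j $ b + 0 * V $ j $ b) + V $ j $ b * ?P 0 $ i $ j))) (at 0)"
    by (intro DERIV_sum DERIV_cmult DERIV_mult P lin)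
  also have "(\<Sum>i\<in>UNIV. \<Sum>j\<in>UNIV. H $ a $ i * (?P' i j * (Z $ j $ b + 0 * V $ j $ b) + V $ j $ b * ?P 0 $ i $ j))
     = (\<Sum>i\<in>UNIV. \<Sum>j\<in>UNIV. H $ a $ i * Z $ j $ b * ?P' i j) + (\<Sum>i\<in>UNIV. \<Sum>j\<in>UNIV. H $ a $ i * V $ j $ b * ?P 0 $ i $ j)"
    unfolding sum.distrib[symmetric] by (intro sum.cong refl) (simp only: algebra_simps mult_zero_left add_0_right)
  also have "(\<Sum>i\<in>UNIV. \<Sum>j\<in>UNIV. H $ a $ i * V $ j $ b * ?P 0 $ i $ j) = (\<Sum>i\<in>UNIV. H $ a $ i * g l $ i * V $ i $ b)"
    by (intro sum.cong refl) (simp add: P0 if_distrib[of "\<lambda>x. _ * x"] mult_ac cong: if_cong)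
  also have "(\<lambda>t. \<Sum>i\<in>UNIV. \<Sum>j\<in>UNIV. H $ a $ i * (?P t $ i $ j * (Z $ j $ b + t * V $ j $ b)))
     = (\<lambda>t. shrinkY g (Y + t *\<^sub>R E) $ a $ b)"
    by (simp only: ent)
  finally show ?thesis by (simp add: T1_entry cong: if_cong)
qed

text \<open>Openness turns differentiability relative to this set into differentiability at each of
  its points.\<close>

lemma open_simple_pos_spectra: "open (simple_pos_spectra :: (real^('p::{finite,linorder})) set)"
proof -
  have eq: "simple_pos_spectra = (\<Inter>i. {l. 0 < l $ i}) \<inter> (\<Inter>i. \<Inter>j. {l :: (real, 'p) vec. i < j \<longrightarrow> l $ j < l $ i})"
    by auto
  have "open {l :: (real, 'p) vec. i < j \<longrightarrow> l $ j < l $ i}" for i j :: 'p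
    by (cases "i < j") (auto intro!: open_Collect_less continuous_intros)
  moreover have "open {l :: (real, 'p) vec. 0 < l $ i}" for i :: 'p
    by (auto intro!: open_Collect_less continuous_intros)
  ultimately show ?thesis unfolding eq by (intro open_Int open_INT) auto
qed

lemma pderiv_g_eq:
  assumes "(g has_derivative g') (at l)"
  shows "pderiv_g g i l = g' (axis i 1) $ i"
proof -
  have "((\<lambda>t. l + t *\<^sub>R axis i 1) has_derivative (\<lambda>t. t *\<^sub>R axis i 1)) (at 0)"
    by (auto intro!: derivative_eq_intros)
  then have "((g \<circ> (\<lambda>t. l + t *\<^sub>R axis i 1)) has_derivative (g' \<circ> (\<lambda>t. t *\<^sub>R axis i 1))) (at 0)"
    by (rule diff_chain_at) (simp add: assms)
  then have "((\<lambda>t. g (l + t *\<^sub>R axis i 1) $ i) has_derivative (\<lambda>t. g' (t *\<^sub>R axis i 1) $ i)) (at 0)"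
    unfolding o_def by (rule bounded_linear.has_derivative[OF bounded_linear_vec_nth])
  then have "((\<lambda>t. g (l + t *\<^sub>R axis i 1) $ i) has_real_derivative g' (axis i 1) $ i) (at 0)"
    using linear_scale[OF has_derivative_linear[OF assms]]
    by (simp add: has_field_derivative_def mult_commute_abs)
  then show ?thesis unfolding pderiv_g_def by (rule DERIV_imp_deriv)
qed

lemma linear_component_sum:
  fixes g' :: "real^'p \<Rightarrow> real^'p"
  assumes "linear g'"
  shows "g' v $ i = (\<Sum>k\<in>UNIV. v $ k * g' (axis k 1) $ i)"
proof -
  have "g' v = g' (\<Sum>k\<in>UNIV. v $ k *s axis k 1)" by (simp add: basis_expansion)
  also have "\<dots> = (\<Sum>k\<in>UNIV. v $ k *\<^sub>R g' (axis k 1))"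
    by (simp add: linear_sum[OF assms] linear_scale[OF assms] scalar_mult_eq_scaleR)
  finally show ?thesis by simp
qed

text \<open>For the direction \<open>unit_mat a b\<close> the perturbation has entries
  \<open>H $ a $ i * Z $ j $ b\<close>, so the sums over a and b decouple: one meets the orthonormal
  columns of \<open>H\<close>, the other the orthogonal rows of \<open>Z\<close>, whose squared
  lengths are the eigenvalues.\<close>

lemma shrinkY_divergence:
  fixes Y :: "real^'m^('p::{finite,linorder})"
    and g :: "real^('p::{finite,linorder}) \<Rightarrow> real^('p::{finite,linorder})"
  defines "l \<equiv> specL (Y ** transpose Y)"
  assumes l: "l \<in> simple_pos_spectra" and diff: "g differentiable_on simple_pos_spectra"
  shows "(\<Sum>a\<in>UNIV. \<Sum>b\<in>UNIV. pderiv_entry (shrinkY g) a b Y)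
    = (\<Sum>i\<in>UNIV. real CARD('m) * g l $ i + 2 * (l $ i * pderiv_g g i l)
         + l $ i * (\<Sum>k\<in>UNIV - {i}. (g l $ i - g l $ k) / (l $ i - l $ k)))"
proof -
  obtain g' where g: "(g has_derivative g') (at l)"
    using diff l differentiable_on_eq_differentiable_at[OF open_simple_pos_spectra, of g]
    unfolding differentiable_def by blast
  have lin: "linear g'" using g by (rule has_derivative_linear)
  define H where "H = specH (Y ** transpose Y)"
  have sym: "transpose (Y ** transpose Y) = Y ** transpose Y" by (simp add: matrix_transpose_mul)
  note spec = spec_decomp[OF sym, folded H_def l_def]
  note HH = orthogonal_matrix_sums[OF spec(1)]
  define Z where "Z = transpose H ** Y"
  have "Z ** transpose Z = diag_mat l"
    using orthogonal_conj_cancel[OF spec(1,2)] by (simp add: Z_def matrix_transpose_mul matrix_mul_assoc)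
  then have "(Z ** transpose Z) $ i $ j = diag_mat l $ i $ j" for i j by simp
  then have ZZ: "(\<Sum>b\<in>UNIV. Z $ i $ b * Z $ j $ b) = (if i = j then l $ i else 0)" for i j
    by (simp add: matrix_mult_entry transpose_def diag_mat_def)
  have V: "(transpose H ** unit_mat a b) $ i $ c = (if c = b then H $ a $ i else 0)" for a b i c
    by (cases "c = b") (simp_all add: matrix_mult_entry transpose_def unit_mat_def if_distrib[of "\<lambda>x. _ * x"] cong: if_cong)
  have VZ: "((transpose H ** unit_mat a b) ** transpose Z) $ i $ j = H $ a $ i * Z $ j $ b" for a b i j
    by (subst matrix_mult_entry) (simp add: V transpose_entry if_distrib[of "\<lambda>x. x * _"] cong: if_cong)
  define phi where "phi i j = (g l $ i - g l $ j) / (l $ i - l $ j)" for i j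
  have phi_sym: "phi i j = phi j i" for i j
    unfolding phi_def by (metis minus_diff_eq minus_divide_divide)
  define D where "D a b i j = (if i = j then g' (\<chi> k. 2 * (H $ a $ k * Z $ k $ b)) $ i
         else (H $ a $ i * Z $ j $ b + H $ a $ j * Z $ i $ b) * phi i j)" for a b i j
  have pd: "pderiv_entry (shrinkY g) a b Y
      = (\<Sum>i\<in>UNIV. \<Sum>j\<in>UNIV. H $ a $ i * Z $ j $ b * D a b i j) + (\<Sum>i\<in>UNIV. H $ a $ i * g l $ i * H $ a $ i)" for a b
    unfolding pderiv_entry_def
    using shrinkY_has_derivative[of Y g g' "unit_mat a b" a b, folded H_def l_def, folded Z_def, OF l g]
    by (intro DERIV_imp_deriv) (simp add: VZ V D_def phi_def cong: if_cong)
  \<comment> \<open>Of the partial derivatives of g_i only the one for k = i survives the two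
    orthogonality relations.\<close>
  have diag: "(\<Sum>a\<in>UNIV. \<Sum>b\<in>UNIV. H $ a $ i * Z $ i $ b * D a b i i) = 2 * (l $ i * pderiv_g g i l)" for i
  proof -
    have "D a b i i = (\<Sum>k\<in>UNIV. 2 * (H $ a $ k * Z $ k $ b) * g' (axis k 1) $ i)" for a b
      unfolding D_def by (simp, subst linear_component_sum[OF lin]) simp
    then have "(\<Sum>a\<in>UNIV. \<Sum>b\<in>UNIV. H $ a $ i * Z $ i $ b * D a b i i)
        = (\<Sum>a\<in>UNIV. \<Sum>b\<in>UNIV. \<Sum>k\<in>UNIV. 2 * g' (axis k 1) $ i * ((H $ a $ i * H $ a $ k) * (Z $ i $ b * Z $ k $ b)))"
      by (simp add: sum_distrib_left mult_ac)
    also have "\<dots> = (\<Sum>a\<in>UNIV. \<Sum>k\<in>UNIV. \<Sum>b\<in>UNIV. 2 * g' (axis k 1) $ i * ((H $ a $ i * H $ a $ k) * (Z $ i $ b * Z $ k $ b)))"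
      by (intro sum.cong refl) (rule sum.swap)
    also have "\<dots> = (\<Sum>k\<in>UNIV. \<Sum>a\<in>UNIV. \<Sum>b\<in>UNIV. 2 * g' (axis k 1) $ i * ((H $ a $ i * H $ a $ k) * (Z $ i $ b * Z $ k $ b)))"
      by (rule sum.swap)
    also have "\<dots> = (\<Sum>k\<in>UNIV. 2 * g' (axis k 1) $ i * ((\<Sum>a\<in>UNIV. H $ a $ i * H $ a $ k) * (\<Sum>b\<in>UNIV. Z $ i $ b * Z $ k $ b)))"
      unfolding sum_product unfolding sum_distrib_left ..
    also have "\<dots> = (\<Sum>k\<in>UNIV. if k = i then 2 * g' (axis i 1) $ i * l $ i else 0)"
      by (intro sum.cong refl) (simp add: HH ZZ)
    also have "\<dots> = 2 * (l $ i * pderiv_g g i l)" by (simp add: pderiv_g_eq[OF g])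
    finally show ?thesis .
  qed
  \<comment> \<open>The first product in \<open>D\<close> yields \<open>l $ j\<close>; the second
    meets two different columns of \<open>H\<close> and sums to zero.\<close>
  have off: "(\<Sum>a\<in>UNIV. \<Sum>b\<in>UNIV. H $ a $ i * Z $ j $ b * D a b i j) = phi i j * l $ j" if "i \<noteq> j" for i j
  proof -
    have "(\<Sum>a\<in>UNIV. \<Sum>b\<in>UNIV. H $ a $ i * Z $ j $ b * D a b i j)
        = (\<Sum>a\<in>UNIV. \<Sum>b\<in>UNIV. phi i j * ((H $ a $ i * H $ a $ i) * (Z $ j $ b * Z $ j $ b)))
        + (\<Sum>a\<in>UNIV. \<Sum>b\<in>UNIV. phi i j * ((H $ a $ i * H $ a $ j) * (Z $ j $ b * Z $ i $ b)))"
      using that by (simp add: D_def sum.distrib[symmetric] algebra_simps)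
    also have "\<dots> = phi i j * ((\<Sum>a\<in>UNIV. H $ a $ i * H $ a $ i) * (\<Sum>b\<in>UNIV. Z $ j $ b * Z $ j $ b))
        + phi i j * ((\<Sum>a\<in>UNIV. H $ a $ i * H $ a $ j) * (\<Sum>b\<in>UNIV. Z $ j $ b * Z $ i $ b))"
      unfolding sum_product unfolding sum_distrib_left ..
    finally show ?thesis using that by (simp add: HH ZZ)
  qed
  have "(\<Sum>a\<in>UNIV. \<Sum>b\<in>UNIV. pderiv_entry (shrinkY g) a b Y)
     = (\<Sum>a\<in>UNIV. \<Sum>b\<in>UNIV. \<Sum>i\<in>UNIV. \<Sum>j\<in>UNIV. H $ a $ i * Z $ j $ b * D a b i j)
     + (\<Sum>a\<in>UNIV. \<Sum>b\<in>(UNIV::'m set). \<Sum>i\<in>UNIV. H $ a $ i * g l $ i * H $ a $ i)"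
    by (simp only: pd sum.distrib)
  \<comment> \<open>The direct variation of Y does not depend on b, so each of the n - 1 columns
    contributes equally.\<close>
  also have "(\<Sum>a\<in>UNIV. \<Sum>b\<in>(UNIV::'m set). \<Sum>i\<in>UNIV. H $ a $ i * g l $ i * H $ a $ i)
     = (\<Sum>i\<in>UNIV. real CARD('m) * g l $ i)"
  proof -
    have "(\<Sum>a\<in>UNIV. \<Sum>b\<in>(UNIV::'m set). \<Sum>i\<in>UNIV. H $ a $ i * g l $ i * H $ a $ i)
      = real CARD('m) * (\<Sum>a\<in>UNIV. \<Sum>i\<in>UNIV. g l $ i * (H $ a $ i * H $ a $ i))"
      by (simp add: sum_distrib_left mult_ac)
    also have "(\<Sum>a\<in>UNIV. \<Sum>i\<in>UNIV. g l $ i * (H $ a $ i * H $ a $ i)) = (\<Sum>i\<in>UNIV. g l $ i * (\<Sum>a\<in>UNIV. H $ a $ i * H $ a $ i))"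
      by (subst sum.swap) (simp only: sum_distrib_left)
    finally show ?thesis by (simp add: HH sum_distrib_left)
  qed
  also have "(\<Sum>a\<in>UNIV. \<Sum>b\<in>UNIV. \<Sum>i\<in>UNIV. \<Sum>j\<in>UNIV. H $ a $ i * Z $ j $ b * D a b i j)
     = (\<Sum>i\<in>UNIV. \<Sum>j\<in>UNIV. \<Sum>a\<in>UNIV. \<Sum>b\<in>UNIV. H $ a $ i * Z $ j $ b * D a b i j)"
  proof -
    have "(\<Sum>a\<in>UNIV. \<Sum>b\<in>UNIV. \<Sum>i\<in>UNIV. \<Sum>j\<in>UNIV. H $ a $ i * Z $ j $ b * D a b i j) = (\<Sum>a\<in>UNIV. \<Sum>i\<in>UNIV. \<Sum>b\<in>UNIV. \<Sum>j\<in>UNIV. H $ a $ i * Z $ j $ b * D a b i j)"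
      by (rule sum.cong[OF refl], rule sum.swap)
    also have "\<dots> = (\<Sum>i\<in>UNIV. \<Sum>a\<in>UNIV. \<Sum>b\<in>UNIV. \<Sum>j\<in>UNIV. H $ a $ i * Z $ j $ b * D a b i j)" by (rule sum.swap)
    also have "\<dots> = (\<Sum>i\<in>UNIV. \<Sum>a\<in>UNIV. \<Sum>j\<in>UNIV. \<Sum>b\<in>UNIV. H $ a $ i * Z $ j $ b * D a b i j)"
      by (rule sum.cong[OF refl], rule sum.cong[OF refl], rule sum.swap)
    also have "\<dots> = (\<Sum>i\<in>UNIV. \<Sum>j\<in>UNIV. \<Sum>a\<in>UNIV. \<Sum>b\<in>UNIV. H $ a $ i * Z $ j $ b * D a b i j)"
      by (rule sum.cong[OF refl], rule sum.swap)
    finally show ?thesis .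
  qed
  also have "\<dots> = (\<Sum>i\<in>UNIV. 2 * (l $ i * pderiv_g g i l)) + (\<Sum>i\<in>UNIV. \<Sum>j\<in>UNIV - {i}. phi i j * l $ j)"
    unfolding sum.distrib[symmetric]
  proof (intro sum.cong refl)
    fix i
    show "(\<Sum>j\<in>UNIV. \<Sum>a\<in>UNIV. \<Sum>b\<in>UNIV. H $ a $ i * Z $ j $ b * D a b i j)
        = 2 * (l $ i * pderiv_g g i l) + (\<Sum>j\<in>UNIV - {i}. phi i j * l $ j)"
      by (subst sum.remove[of UNIV i "\<lambda>j. \<Sum>a\<in>UNIV. \<Sum>b\<in>UNIV. H $ a $ i * Z $ j $ b * D a b i j"])
        (auto simp: diag off)
  qed
  \<comment> \<open>Exchanging the names of i and j, which leaves \<open>phi\<close> unchanged,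
    moves the weight from \<open>l $ j\<close> to \<open>l $ i\<close>.\<close>
  also have "(\<Sum>i\<in>UNIV. \<Sum>j\<in>UNIV - {i}. phi i j * l $ j) = (\<Sum>i\<in>UNIV. l $ i * (\<Sum>j\<in>UNIV - {i}. phi i j))"
  proof -
    have "(\<Sum>i\<in>UNIV. \<Sum>j\<in>UNIV - {i}. phi i j * l $ j) = (\<Sum>i\<in>UNIV. \<Sum>j\<in>UNIV. if i = j then 0 else phi i j * l $ j)"
      by (intro sum.cong refl sum.mono_neutral_cong_left) auto
    also have "\<dots> = (\<Sum>j\<in>UNIV. \<Sum>i\<in>UNIV. if i = j then 0 else phi i j * l $ j)" by (rule sum.swap)
    also have "\<dots> = (\<Sum>j\<in>UNIV. \<Sum>i\<in>UNIV - {j}. phi i j * l $ j)"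
      by (intro sum.cong refl sum.mono_neutral_cong_right) auto
    finally show ?thesis by (simp add: sum_distrib_left phi_sym mult.commute)
  qed
  finally show ?thesis by (simp only: sum.distrib phi_def add_ac)
qed

section \<open>Unbiased risk estimate\<close>

lemma measurable_matnormal_density [measurable]:
  fixes Th :: "real^'n^'p"
  shows "matnormal_density Sig Th \<in> borel_measurable borel"
proof (rule borel_measurable_continuous_onI)
  have "continuous_on UNIV (\<lambda>X :: real^'n^'p. column i X)" for i
    unfolding column_def by (intro continuous_intros)
  then show "continuous_on UNIV (matnormal_density Sig Th)"
    unfolding matnormal_density_def divide_inverse
    by (intro continuous_intros continuous_on_prod matrix_vector_mult_linear_continuous_on[THEN continuous_on_compose2]) auto
qed

lemma measurable_loss:
  fixes Th :: "real^'n^'p"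
  shows "(\<lambda>X. loss Sig Th X) \<in> borel_measurable borel"
  unfolding loss_def trace_def matrix_mult_entry transpose_def
  by (intro borel_measurable_continuous_onI) (auto intro!: continuous_intros simp: matrix_mult_entry)

lemma sets_matnormal [simp, measurable_cong]: "sets (matnormal Sig Th) = sets borel"
  by (simp add: matnormal_def)

lemma AE_matnormal:
  assumes "AE X in lborel. P X"
  shows "AE X in matnormal Sig Th. P X"
  using assms unfolding matnormal_def by (subst AE_density) auto

text \<open>Pointwise, the estimator is the squared norm from the loss expansion minus twice the
  divergence. Positivity of the spectrum lets the factor \<open>l $ i\<close> cancel against the
  quotient by \<open>l $ i\<close>.\<close>

lemma DeltaG_eq_shrinkY:
  fixes X :: "real^'n^('p::{finite,linorder})" and O1 :: "real^'m^'n"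
    and g :: "real^('p::{finite,linorder}) \<Rightarrow> real^('p::{finite,linorder})"
  assumes pd: "sym_pd Sig"
    and card: "CARD('m) + 1 = CARD('n)"
    and orth: "transpose O1 ** O1 = mat 1"
    and proj: "O1 ** transpose O1 = mat 1 - (\<chi> i j. 1 / real CARD('n))"
    and diff: "g differentiable_on simple_pos_spectra"
    and simple: "specL (Smat Sig X) \<in> simple_pos_spectra"
  defines "Y \<equiv> matrix_inv (msqrt Sig) ** X ** O1" and "l \<equiv> specL (Smat Sig X)"
  shows "DeltaG Sig g X = (\<Sum>i\<in>UNIV. l $ i * (g l $ i)\<^sup>2)
    - 2 * (\<Sum>a\<in>UNIV. \<Sum>b\<in>UNIV. pderiv_entry (shrinkY g) a b Y)"
proof -
  have S: "Smat Sig X = Y ** transpose Y" using Smat_eq[OF pd orth proj] by (simp add: Y_def)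
  have l: "l = specL (Y ** transpose Y)" by (simp add: l_def S)
  have lpos: "l $ i \<noteq> 0" for i using simple by (simp add: l_def less_imp_neq[THEN not_sym])
  have m: "real CARD('n) - 1 = real CARD('m)" using card by linarith
  have "DeltaG Sig g X = (\<Sum>i\<in>UNIV. l $ i * (g l $ i)\<^sup>2 - 2 * (real CARD('m) * g l $ i + 2 * (l $ i * pderiv_g g i l)
         + l $ i * (\<Sum>k\<in>UNIV - {i}. (g l $ i - g l $ k) / (l $ i - l $ k))))"
    unfolding DeltaG_def l_def[symmetric] Let_def m
    by (rule sum.cong) (simp_all add: algebra_simps lpos)
  also have "\<dots> = (\<Sum>i\<in>UNIV. l $ i * (g l $ i)\<^sup>2)
      - 2 * (\<Sum>a\<in>UNIV. \<Sum>b\<in>UNIV. pderiv_entry (shrinkY g) a b Y)"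
    using shrinkY_divergence[of Y g, folded l, OF _ diff] simple
    by (simp add: sum_subtractf sum_distrib_left l_def)
  finally show ?thesis .
qed

theorem theoremA1:
  fixes Sig :: "real^('p::{finite,linorder})^('p::{finite,linorder})"
    and Th :: "real^'n^('p::{finite,linorder})"
    and g :: "real^('p::{finite,linorder}) \<Rightarrow> real^('p::{finite,linorder})"
    and O1 :: "real^'m^'n"
  assumes pd: "sym_pd Sig"
    and m_def: "CARD('m) + 1 = CARD('n)"
    and np: "CARD('p) \<le> CARD('n) - 1"
    and O1_orth: "transpose O1 ** O1 = mat 1"
    and O1_proj: "O1 ** transpose O1 = mat 1 - (\<chi> i j. 1 / real CARD('n))"
    and g_diff: "g differentiable_on {l. (\<forall>i. 0 < l $ i) \<and> (\<forall>i j. i < j \<longrightarrow> l $ j < l $ i)}"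
    and int_Delta: "integrable (matnormal Sig Th) (DeltaG Sig g)"
    and int_loss: "integrable (matnormal Sig Th) (\<lambda>X. loss Sig Th (ThetaG Sig g X))"
    and stein: "\<And>a b.
         integrable (matnormal Sig Th)
           (\<lambda>X. ((matrix_inv (msqrt Sig) ** X ** O1) $ a $ b - (matrix_inv (msqrt Sig) ** Th ** O1) $ a $ b)
                * shrinkY g (matrix_inv (msqrt Sig) ** X ** O1) $ a $ b)
       \<and> integrable (matnormal Sig Th)
           (\<lambda>X. pderiv_entry (shrinkY g) a b (matrix_inv (msqrt Sig) ** X ** O1))
       \<and> integral\<^sup>L (matnormal Sig Th)
           (\<lambda>X. ((matrix_inv (msqrt Sig) ** X ** O1) $ a $ b - (matrix_inv (msqrt Sig) ** Th ** O1) $ a $ b)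
                * shrinkY g (matrix_inv (msqrt Sig) ** X ** O1) $ a $ b)
         = integral\<^sup>L (matnormal Sig Th)
           (\<lambda>X. pderiv_entry (shrinkY g) a b (matrix_inv (msqrt Sig) ** X ** O1))"
  shows "integral\<^sup>L (matnormal Sig Th) (DeltaG Sig g)
         = real CARD('n) * real CARD('p) * (risk Sig Th (ThetaG Sig g) - risk Sig Th (\<lambda>X. X))"
proof -
  let ?M = "matnormal Sig Th" and ?Ri = "matrix_inv (msqrt Sig)"
  define np where "np = real CARD('n) * real CARD('p)"
  define A where "A X = (\<Sum>a\<in>UNIV. \<Sum>b\<in>UNIV. ((?Ri ** X ** O1) $ a $ b - (?Ri ** Th ** O1) $ a $ b)
      * shrinkY g (?Ri ** X ** O1) $ a $ b)" for X
  define D where "D X = (\<Sum>a\<in>UNIV. \<Sum>b\<in>UNIV. pderiv_entry (shrinkY g) a b (?Ri ** X ** O1))" for X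
  have intA: "integrable ?M A" and intD: "integrable ?M D"
    unfolding A_def D_def using stein by (auto intro!: Bochner_Integration.integrable_sum)
  have AD: "integral\<^sup>L ?M A = integral\<^sup>L ?M D"
    unfolding A_def D_def using stein by (simp add: Bochner_Integration.integral_sum Bochner_Integration.integrable_sum)
  have card: "CARD('p) \<le> CARD('m)" using \<open>CARD('p) \<le> CARD('n) - 1\<close> m_def by linarith
  note inv = matrix_inv_inverse[OF sym_pd_invertible[OF msqrt(1)[OF pd]]]
  have "AE X in ?M. specL ((?Ri ** X ** O1) ** transpose (?Ri ** X ** O1)) \<in> simple_pos_spectra"
    by (rule AE_matnormal, rule AE_simple_pos_spectrum[OF card inv O1_orth])
  \<comment> \<open>The sum of l_i g_i^2 is eliminated between \<open>loss_ThetaG\<close> and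
    \<open>DeltaG_eq_shrinkY\<close>; what remains of the shrinkage map is \<open>A\<close> and
    \<open>D\<close>, whose integrals agree by \<open>AD\<close>.\<close>
  then have ae: "AE X in ?M. np * loss Sig Th (ThetaG Sig g X) + 2 * A X - 2 * D X - DeltaG Sig g X = np * loss Sig Th X"
  proof (rule AE_mp, intro AE_I2 impI)
    fix X assume "specL ((?Ri ** X ** O1) ** transpose (?Ri ** X ** O1)) \<in> simple_pos_spectra"
    then have simple: "specL (Smat Sig X) \<in> simple_pos_spectra" by (simp only: Smat_eq[OF pd O1_orth O1_proj])
    show "np * loss Sig Th (ThetaG Sig g X) + 2 * A X - 2 * D X - DeltaG Sig g X = np * loss Sig Th X"
      using loss_ThetaG[OF pd O1_orth O1_proj, of Th g X] DeltaG_eq_shrinkY[OF pd m_def O1_orth O1_proj g_diff simple]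
      by (simp add: np_def A_def D_def)
  qed
  \<comment> \<open>The loss of X is continuous, so the a.e. identity also yields its integrability.\<close>
  have int: "integrable ?M (\<lambda>X. np * loss Sig Th (ThetaG Sig g X) + 2 * A X - 2 * D X - DeltaG Sig g X)"
    using int_loss int_Delta intA intD by auto
  have meas: "(\<lambda>X. np * loss Sig Th X) \<in> borel_measurable ?M"
    using measurable_loss[of Sig Th] by (simp cong: measurable_cong_sets)
  have "integral\<^sup>L ?M (\<lambda>X. np * loss Sig Th (ThetaG Sig g X) + 2 * A X - 2 * D X - DeltaG Sig g X)
      = integral\<^sup>L ?M (\<lambda>X. np * loss Sig Th X)"
    using int meas ae by (intro integral_cong_AE) auto
  moreover have "integral\<^sup>L ?M (\<lambda>X. np * loss Sig Th (ThetaG Sig g X) + 2 * A X - 2 * D X - DeltaG Sig g X)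
      = np * risk Sig Th (ThetaG Sig g) + 2 * integral\<^sup>L ?M A - 2 * integral\<^sup>L ?M D - integral\<^sup>L ?M (DeltaG Sig g)"
    using int_loss int_Delta intA intD by (simp add: risk_def)
  ultimately show ?thesis by (simp add: AD risk_def np_def algebra_simps)
qed

end
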